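(* Let $(X,\tau)$ be a sequentially complete Hausdorff locally convex space, let $(T_t)_{t\ge 0}$ be a locally sequentially equicontinuous (possibly even sequentially equicontinuous), equibounded $C_0$-semigroup on $(X,\tau)$ with generator $-A$, let $f$ be a Bernstein function, and let $-A^f$ be the generator of the subordinated semigroup $(S_t)_{t\geq 0}$ to $(T_t)_{t\geq 0}$ with respect to $f$. Then $\mathcal D(A)\subseteq\mathcal D(A^f)$ and $A^f|_{\mathcal D(A)}=A_f$.
   Context: Let $\tau$ be generated by a directed family of seminorms $(\|\cdot\|_p)_{p\in\mathcal P}$. A semigroup $(T_t)_{t\ge 0}$ on $X$ is a family of linear operators $T_t\colon X\to X$ with $T_0=I$, $T_{s+t}=T_sT_t$. It is a $C_0$-semigroup on $(X,\tau)$ if $\lim_{t\to 0+}T_tx=x$ for all $x$; locally sequentially equicontinuous if for every sequence $x_n\to 0$, every $t_0>0$, $p\in\mathcal P$ one has $\lim_{n}\sup_{t\in[0,t_0]}\|T_tx_n\|_p=0$ (sequentially equicontinuous if this holds with $[0,\infty)$ in place of $[0,t_0]$); equibounded if $\sup_{x\in B,\,t\ge0}\|T_tx\|_p<\infty$ for every bounded $B\subseteq X$, $p\in\mathcal P$. The generator $-A$ of $(T_t)$ is given by $\mathcal D(A)=\{x\in X:\lim_{t\to0+}\frac1t(T_tx-x)\text{ exists}\}$, $-Ax=\lim_{t\to0+}\frac1t(T_tx-x)$. Integrals of $X$-valued functions are Pettis integrals: $x=\int_\Omega g\,\mathrm{d}\mu$ means $\langle x',x\rangle=\int_\Omega\langle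 x',g\rangle\,\mathrm{d}\mu$ for all $x'\in X'$ (with all $\langle x',g\rangle$ in $L^1(\mu)$). A Bernstein function is $f\in C^\infty(0,\infty)$, $f\colon(0,\infty)\to[0,\infty)$, with $(-1)^{k-1}f^{(k)}\ge0$ for all $k\in\{1,2,\dots\}$. Such $f$ has a unique Lévy triplet $(a,b,\mu)$: $a,b\ge0$ and $\mu$ a positive Radon measure on $(0,\infty)$ with $\int_{(0,\infty)}\min(1,t)\,\mu(\mathrm{d}t)<\infty$ and $f(\lambda)=a+b\lambda+\int_{(0,\infty)}(1-e^{-\lambda t})\,\mu(\mathrm{d}t)$ for $\lambda>0$. Also, there is a unique family $(\mu_t)_{t\ge0}$ of Radon measures on $[0,\infty)$ with $\mu_t([0,\infty))\le1$, $\mu_0=\delta_0$, $\mu_t*\mu_s=\mu_{t+s}$, vaguely continuous, whose Laplace transforms are $\int_{[0,\infty)}e^{-\lambda s}\mu_t(\mathrm{d}s)=e^{-tf(\lambda)}$ ($\lambda>0$, $t\geq 0$). The subordinated semigroup to $(T_t)$ w.r.t. $f$ is $S_tx:=\int_{[0,\infty)}T_sx\,\mu_t(\mathrm{d}s)$; it is again a locally sequentially equicontinuous, equibounded $C_0$-semigroup on $(X,\tau)$, and its generator (defined in the same way) is denoted $-A^f$. The linear operator $A_f$ is defined by $\mathcal D(A_f):=\mathcal D(A)$ and $A_fx:=ax+bAx+\int_{(0,\infty)}(x-T_tx)\,\mu(\mathrm{d}t)$, where the Pettis integral exists for $x\in\mathcal D(A)$. *)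

theory Defs
  imports "HOL-Probability.Probability"
begin

section \<open>Locally convex spaces\<close>

text \<open>
  The ground field is a type \<open>'k :: {real_normed_field, euclidean_space}\<close>. Both \<^typ>\<open>real\<close> and
  \<^typ>\<open>complex\<close> are instances and, by the theorem of Frobenius, every instance is isomorphic as a
  normed field to one of them. The space X is the whole type \<open>'a\<close>, with scalar multiplication
  \<open>smul :: 'k \<Rightarrow> 'a \<Rightarrow> 'a\<close>, and its topology is given by a directed set P of seminorms.
\<close>

definition seminorm ::
    "('k::{real_normed_field,euclidean_space} \<Rightarrow> 'a::ab_group_add \<Rightarrow> 'a) \<Rightarrow> ('a \<Rightarrow> real) \<Rightarrow> bool" where
  "seminorm smul p \<longleftrightarrow>
     (\<forall>x. 0 \<le> p x) \<and> (\<forall>x y. p (x + y) \<le> p x + p y) \<and> (\<forall>c x. p (smul c x) = norm c * p x)"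

definition directed_seminorms :: "('a \<Rightarrow> real) set \<Rightarrow> bool" where
  "directed_seminorms P \<longleftrightarrow>
     P \<noteq> {} \<and> (\<forall>p\<in>P. \<forall>q\<in>P. \<exists>r\<in>P. \<exists>C. \<forall>x. max (p x) (q x) \<le> C * r x)"

definition seminorm_topology :: "('a::ab_group_add \<Rightarrow> real) set \<Rightarrow> 'a topology" where
  "seminorm_topology P =
     topology_generated_by {{y. p (y - x) < r} | p x r. p \<in> P \<and> 0 < r}"

definition seminorm_Cauchy :: "('a::ab_group_add \<Rightarrow> real) set \<Rightarrow> (nat \<Rightarrow> 'a) \<Rightarrow> bool" where
  "seminorm_Cauchy P xs \<longleftrightarrow>
     (\<forall>p\<in>P. \<forall>e>0. \<exists>N. \<forall>m\<ge>N. \<forall>n\<ge>N. p (xs m - xs n) < e)"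

definition seminorm_bounded :: "('a \<Rightarrow> real) set \<Rightarrow> 'a set \<Rightarrow> bool" where
  "seminorm_bounded P B \<longleftrightarrow> (\<forall>p\<in>P. \<exists>C. \<forall>x\<in>B. p x \<le> C)"

definition seq_complete_Hausdorff_lcs ::
    "('k::{real_normed_field,euclidean_space} \<Rightarrow> 'a::ab_group_add \<Rightarrow> 'a) \<Rightarrow> ('a \<Rightarrow> real) set \<Rightarrow> bool" where
  "seq_complete_Hausdorff_lcs smul P \<longleftrightarrow>
     vector_space smul \<and>
     (\<forall>p\<in>P. seminorm smul p) \<and> directed_seminorms P \<and>
     Hausdorff_space (seminorm_topology P) \<and>
     (\<forall>xs. seminorm_Cauchy P xs \<longrightarrow> (\<exists>l. limitin (seminorm_topology P) xs l sequentially))"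

definition continuous_dual ::
    "('k::{real_normed_field,euclidean_space} \<Rightarrow> 'a::ab_group_add \<Rightarrow> 'a) \<Rightarrow> ('a \<Rightarrow> real) set \<Rightarrow> ('a \<Rightarrow> 'k) set" where
  "continuous_dual smul P =
     {x'. Vector_Spaces.linear smul (*) x' \<and> continuous_map (seminorm_topology P) euclidean x'}"


section \<open>Pettis integral\<close>

definition has_Pettis_integral ::
    "('k::{real_normed_field,euclidean_space} \<Rightarrow> 'a::ab_group_add \<Rightarrow> 'a) \<Rightarrow> ('a \<Rightarrow> real) set \<Rightarrow>
     'w measure \<Rightarrow> 'w set \<Rightarrow> ('w \<Rightarrow> 'a) \<Rightarrow> 'a \<Rightarrow> bool" where
  "has_Pettis_integral smul P M \<Omega> g x \<longleftrightarrow>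
     (\<forall>x' \<in> continuous_dual smul P.
        set_integrable M \<Omega> (\<lambda>w. x' (g w)) \<and> x' x = (LINT w:\<Omega>|M. x' (g w)))"

definition Pettis_integral ::
    "('k::{real_normed_field,euclidean_space} \<Rightarrow> 'a::ab_group_add \<Rightarrow> 'a) \<Rightarrow> ('a \<Rightarrow> real) set \<Rightarrow>
     'w measure \<Rightarrow> 'w set \<Rightarrow> ('w \<Rightarrow> 'a) \<Rightarrow> 'a" where
  "Pettis_integral smul P M \<Omega> g = (THE x. has_Pettis_integral smul P M \<Omega> g x)"


section \<open>Semigroups\<close>

text \<open>A family of operators indexed by \<open>t \<ge> 0\<close> is a function on \<^typ>\<open>real\<close> of which only the values
  at \<open>t \<ge> 0\<close> are ever used.\<close>

definition operator_semigroup ::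
    "('k::{real_normed_field,euclidean_space} \<Rightarrow> 'a::ab_group_add \<Rightarrow> 'a) \<Rightarrow> (real \<Rightarrow> 'a \<Rightarrow> 'a) \<Rightarrow> bool" where
  "operator_semigroup smul T \<longleftrightarrow>
     (\<forall>t\<ge>0. Vector_Spaces.linear smul smul (T t)) \<and>
     T 0 = id \<and> (\<forall>s\<ge>0. \<forall>t\<ge>0. T (s + t) = T s \<circ> T t)"

definition C0_semigroup ::
    "('k::{real_normed_field,euclidean_space} \<Rightarrow> 'a::ab_group_add \<Rightarrow> 'a) \<Rightarrow> ('a \<Rightarrow> real) set \<Rightarrow>
     (real \<Rightarrow> 'a \<Rightarrow> 'a) \<Rightarrow> bool" where
  "C0_semigroup smul P T \<longleftrightarrow>
     operator_semigroup smul T \<and>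
     (\<forall>x. limitin (seminorm_topology P) (\<lambda>t. T t x) x (at_right 0))"

definition locally_seq_equicontinuous ::
    "('a::ab_group_add \<Rightarrow> real) set \<Rightarrow> (real \<Rightarrow> 'a \<Rightarrow> 'a) \<Rightarrow> bool" where
  "locally_seq_equicontinuous P T \<longleftrightarrow>
     (\<forall>xs. limitin (seminorm_topology P) xs 0 sequentially \<longrightarrow>
        (\<forall>t0>0. \<forall>p\<in>P. (\<lambda>n. SUP t\<in>{0..t0}. ereal (p (T t (xs n)))) \<longlonglongrightarrow> 0))"

definition equibounded ::
    "('a \<Rightarrow> real) set \<Rightarrow> (real \<Rightarrow> 'a \<Rightarrow> 'a) \<Rightarrow> bool" where
  "equibounded P T \<longleftrightarrow>
     (\<forall>B. seminorm_bounded P B \<longrightarrow>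
        (\<forall>p\<in>P. (SUP (x, t)\<in>B \<times> {0..}. ereal (p (T t x))) < \<infinity>))"

text \<open>An operator defined on part of X is a partial function \<open>'a \<rightharpoonup> 'a\<close>; its domain is \<^const>\<open>dom\<close>.\<close>

definition generator ::
    "('k::{real_normed_field,euclidean_space} \<Rightarrow> 'a::ab_group_add \<Rightarrow> 'a) \<Rightarrow> ('a \<Rightarrow> real) set \<Rightarrow>
     (real \<Rightarrow> 'a \<Rightarrow> 'a) \<Rightarrow> ('a \<rightharpoonup> 'a)" where
  "generator smul P T = (\<lambda>x.
     let is_lim = (\<lambda>y. limitin (seminorm_topology P)
                         (\<lambda>t. smul (of_real (1 / t)) (T t x - x)) y (at_right 0))
     in if \<exists>y. is_lim y then Some (THE y. is_lim y) else None)"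

text \<open>The operator A for which \<open>- A\<close> is the generator.\<close>

definition neg_generator ::
    "('k::{real_normed_field,euclidean_space} \<Rightarrow> 'a::ab_group_add \<Rightarrow> 'a) \<Rightarrow> ('a \<Rightarrow> real) set \<Rightarrow>
     (real \<Rightarrow> 'a \<Rightarrow> 'a) \<Rightarrow> ('a \<rightharpoonup> 'a)" where
  "neg_generator smul P T = (\<lambda>x. map_option uminus (generator smul P T x))"


section \<open>Bernstein functions\<close>

text \<open>The values of f outside \<open>(0, \<infinity>)\<close> are irrelevant; smoothness is expressed by differentiability of
  all iterated derivatives.\<close>

definition Bernstein_function :: "(real \<Rightarrow> real) \<Rightarrow> bool" where
  "Bernstein_function f \<longleftrightarrow>
     (\<forall>x>0. 0 \<le> f x) \<and>
     (\<forall>k. \<forall>x>0. (deriv ^^ k) f field_differentiable at x) \<and>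
     (\<forall>k\<ge>1. \<forall>x>0. 0 \<le> (-1) ^ (k - 1) * (deriv ^^ k) f x)"

text \<open>
  A measure on a Borel set S of reals is encoded as a Borel measure on the line that vanishes off S,
  and integrals over it are taken over S. Local finiteness suffices here: for the intervals S
  considered below, regularity is then automatic.
\<close>

definition Radon_measure_on :: "real set \<Rightarrow> real measure \<Rightarrow> bool" where
  "Radon_measure_on S M \<longleftrightarrow>
     sets M = sets borel \<and> emeasure M (- S) = 0 \<and>
     (\<forall>K. compact K \<and> K \<subseteq> S \<longrightarrow> emeasure M K < \<infinity>)"

definition Levy_triplet :: "(real \<Rightarrow> real) \<Rightarrow> real \<Rightarrow> real \<Rightarrow> real measure \<Rightarrow> bool" where
  "Levy_triplet f a b \<mu> \<longleftrightarrow>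
     0 \<le> a \<and> 0 \<le> b \<and> Radon_measure_on {0<..} \<mu> \<and>
     set_integrable \<mu> {0<..} (\<lambda>t. min 1 t) \<and>
     (\<forall>l>0. f l = a + b * l + (LINT t:{0<..}|\<mu>. 1 - exp (- l * t)))"

definition vaguely_continuous :: "(real \<Rightarrow> real measure) \<Rightarrow> bool" where
  "vaguely_continuous \<nu> \<longleftrightarrow>
     (\<forall>\<phi> :: real \<Rightarrow> real. continuous_on {0..} \<phi> \<and> (\<exists>R. \<forall>s>R. \<phi> s = 0) \<longrightarrow>
        continuous_on {0..} (\<lambda>t. LINT s:{0..}|\<nu> t. \<phi> s))"

text \<open>The convolution semigroup \<open>(\<nu> t)\<close>, \<open>t \<ge> 0\<close>, of sub-probability measures on \<open>[0, \<infinity>)\<close> associated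
  with f.\<close>

definition convolution_semigroup_of :: "(real \<Rightarrow> real) \<Rightarrow> (real \<Rightarrow> real measure) \<Rightarrow> bool" where
  "convolution_semigroup_of f \<nu> \<longleftrightarrow>
     (\<forall>t\<ge>0. Radon_measure_on {0..} (\<nu> t) \<and> emeasure (\<nu> t) {0..} \<le> 1) \<and>
     \<nu> 0 = return borel 0 \<and>
     (\<forall>s\<ge>0. \<forall>t\<ge>0. (\<nu> t \<star> \<nu> s) = \<nu> (t + s)) \<and>
     vaguely_continuous \<nu> \<and>
     (\<forall>l>0. \<forall>t\<ge>0. (LINT s:{0..}|\<nu> t. exp (- l * s)) = exp (- t * f l))"


section \<open>Subordination\<close>

definition subordinated_semigroup ::
    "('k::{real_normed_field,euclidean_space} \<Rightarrow> 'a::ab_group_add \<Rightarrow> 'a) \<Rightarrow> ('a \<Rightarrow> real) set \<Rightarrow>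
     (real \<Rightarrow> 'a \<Rightarrow> 'a) \<Rightarrow> (real \<Rightarrow> real measure) \<Rightarrow> real \<Rightarrow> 'a \<Rightarrow> 'a" where
  "subordinated_semigroup smul P T \<nu> t x =
     Pettis_integral smul P (\<nu> t) {0..} (\<lambda>s. T s x)"

text \<open>The operator \<open>A\<^sub>f\<close> for f with triplet \<open>(a, b, \<mu>)\<close>; its domain is that of A.\<close>

definition Bernstein_operator ::
    "('k::{real_normed_field,euclidean_space} \<Rightarrow> 'a::ab_group_add \<Rightarrow> 'a) \<Rightarrow> ('a \<Rightarrow> real) set \<Rightarrow>
     (real \<Rightarrow> 'a \<Rightarrow> 'a) \<Rightarrow> real \<Rightarrow> real \<Rightarrow> real measure \<Rightarrow> ('a \<rightharpoonup> 'a)" where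
  "Bernstein_operator smul P T a b \<mu> = (\<lambda>x.
     map_option
       (\<lambda>Ax. smul (of_real a) x + smul (of_real b) Ax +
             Pettis_integral smul P \<mu> {0<..} (\<lambda>t. x - T t x))
       (neg_generator smul P T x))"

end

theory Submission
  imports Defs
begin

text \<open>
  Let \<open>x\<close> be in the domain and let \<open>y = - A x\<close>. The function \<open>h s = (T s x - x) / (1 - exp (- s))\<close>,
  \<open>h 0 = y\<close>, is bounded and continuous on \<open>[0, \<infinity>)\<close>, and \<open>\<nu> t\<close> has total mass \<open>exp (- t a)\<close>, so that
  \<open>(S t x - x) / t = (exp (- t a) - 1) / t x + \<integral> h dN\<^sub>t\<close> with \<open>N\<^sub>t(ds) = (1 - exp (- s)) / t \<nu>\<^sub>t(ds)\<close>. As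
  \<open>t \<rightarrow> 0\<close>, the Laplace transforms of \<open>N\<^sub>t\<close> converge on \<open>[0, \<infinity>)\<close> to \<open>f (l + 1) - f l\<close> (with
  \<open>f 0\<close> read as the limit \<open>a\<close>), which is the
  Laplace transform of \<open>b \<delta>\<^sub>0 + (1 - exp (- s)) \<mu>(ds)\<close>. Hence the \<open>N\<^sub>t\<close> converge weakly to this measure
  and \<open>\<integral> h dN\<^sub>t\<close> tends to \<open>b y + \<integral> (T s x - x) \<mu>(ds)\<close>.

  Both the existence of the Pettis integrals and the passage from scalar to vector-valued \<open>h\<close> rest on
  Bernstein polynomials in \<open>exp (- s)\<close> with values of \<open>h\<close> as coefficients: they converge to \<open>h\<close>
  pointwise and boundedly in every seminorm, their integrals are finite sums, and the Hahn--Banach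
  theorem gives \<open>p (\<integral> g) \<le> \<integral> p (g)\<close>.
\<close>

section \<open>Sublinear functionals\<close>

text \<open>Scalar multiplication is a parameter because the vectors carry no real vector space
  structure of their own; it will be \<open>rmul\<close>. Negative values are allowed, so that
  linear functionals are sublinear.\<close>

definition sublinear :: "(real \<Rightarrow> 'a::ab_group_add \<Rightarrow> 'a) \<Rightarrow> ('a \<Rightarrow> real) \<Rightarrow> bool" where
  "sublinear sc q \<longleftrightarrow>
     (\<forall>x y. q (x + y) \<le> q x + q y) \<and> (\<forall>r>0. \<forall>x. q (sc r x) = r * q x)"


lemma sublinear_zero:
  assumes "vector_space sc" "sublinear sc q"
  shows "q 0 = 0"
proof -
  interpret vector_space sc by fact
  have "q (sc 2 0) = 2 * q 0"
    using assms(2) unfolding sublinear_def by (meson zero_less_numeral)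
  then show ?thesis by simp
qed

lemma sublinear_ge_minus:
  assumes "vector_space sc" "sublinear sc q"
  shows "- q (- x) \<le> q x"
proof -
  have "q (x + - x) \<le> q x + q (- x)"
    using assms(2) unfolding sublinear_def by blast
  then show ?thesis using sublinear_zero[OF assms] by simp
qed

text \<open>The witness is the infimum of \<open>q (x + sc t y) - t * q y\<close> over
  \<open>t \<ge> 0\<close>: \<open>t = 0\<close> gives \<open>q' \<le> q\<close>, and
  \<open>t = 1\<close> at \<open>- y\<close> gives the last bound. Together with
  \<open>sublinear_ge_minus\<close> that bound makes \<open>q'\<close> odd at
  \<open>y\<close>.\<close>

lemma sublinear_descent:
  assumes V: "vector_space sc" and q: "sublinear sc q"
  obtains q' where "sublinear sc q'" "\<And>x. q' x \<le> q x" "q' (- y) \<le> - q y"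
proof -
  interpret vector_space sc by fact
  have sub: "q (u + v) \<le> q u + q v" for u v
    using q unfolding sublinear_def by blast
  have hom: "q (sc r u) = r * q u" if "r \<ge> 0" for r u
    using q sublinear_zero[OF V q] that unfolding sublinear_def
    by (cases "r = 0") auto
  define g where "g x t = q (x + sc t y) - t * q y" for x t
  define q' where "q' x = (INF t\<in>{0..}. g x t)" for x
  \<comment> \<open>Subadditivity for \<open>sc t y = (x + sc t y) + (- x)\<close>. The bound does
    not depend on \<open>t\<close>, so the infimum is a genuine one.\<close>
  have lb: "- q (- x) \<le> g x t" if "t \<ge> 0" for x t
    using sub[of "x + sc t y" "- x"] hom[OF that, of y] by (simp add: g_def)
  have bdd: "bdd_below (g x ` {0..})" for x
    by (rule bdd_belowI2[where m = "- q (- x)"]) (use lb in auto)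
  have le: "q' x \<le> g x t" if "t \<ge> 0" for x t
    unfolding q'_def by (rule cINF_lower[OF bdd]) (use that in auto)
  have ge: "c \<le> q' x" if "\<And>t. t \<ge> 0 \<Longrightarrow> c \<le> g x t" for c x
    unfolding q'_def by (rule cINF_greatest) (use that in auto)
  have add: "q' (u + v) \<le> q' u + q' v" for u v
  proof -
    have "q' (u + v) - g u s \<le> g v t" if "s \<ge> 0" "t \<ge> 0" for s t
    proof -
      have "q' (u + v) \<le> g (u + v) (s + t)"
        using that by (intro le) auto
      also have "\<dots> = q ((u + sc s y) + (v + sc t y)) - (s + t) * q y"
        by (simp add: g_def scale_left_distrib algebra_simps)
      also have "\<dots> \<le> g u s + g v t"
        using sub[of "u + sc s y" "v + sc t y"] by (simp add: g_def algebra_simps)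
      finally show ?thesis by simp
    qed
    then have "q' (u + v) - q' v \<le> g u s" if "s \<ge> 0" for s
      using ge[of "q' (u + v) - g u s" v] that by fastforce
    then have "q' (u + v) - q' v \<le> q' u" by (rule ge)
    then show ?thesis by simp
  qed
  have scale_le: "q' (sc r u) \<le> r * q' u" if "r > 0" for r u
  proof -
    have "q' (sc r u) / r \<le> g u t" if "t \<ge> 0" for t
    proof -
      have "q' (sc r u) \<le> g (sc r u) (r * t)"
        using that \<open>r > 0\<close> by (intro le) auto
      also have "\<dots> = q (sc r (u + sc t y)) - r * t * q y"
        by (simp add: g_def scale_right_distrib)
      also have "\<dots> = r * g u t"
        using hom[of r "u + sc t y"] \<open>r > 0\<close> by (simp only: g_def) (simp add: algebra_simps)
      finally show ?thesis using \<open>r > 0\<close> by (simp add: field_simps)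
    qed
    then have "q' (sc r u) / r \<le> q' u" by (rule ge)
    then show ?thesis using \<open>r > 0\<close> by (simp add: field_simps)
  qed
  have "q' (sc r u) = r * q' u" if "r > 0" for r u
  proof (rule antisym[OF scale_le[OF that]])
    have "q' (sc (inverse r) (sc r u)) \<le> inverse r * q' (sc r u)"
      using that by (intro scale_le) auto
    then show "r * q' u \<le> q' (sc r u)" using that by (simp add: field_simps)
  qed
  then have "sublinear sc q'" using add unfolding sublinear_def by blast
  moreover have "q' x \<le> q x" for x
    using le[of 0 x] by (simp add: g_def)
  moreover have "q' (- y) \<le> - q y"
    using le[of 1 "- y"] sublinear_zero[OF V q] by (simp add: g_def)
  ultimately show thesis by (rule that)
qed

text \<open>Lower bounds of chains for Zorn's lemma. The common majorant \<open>p\<close> bounds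
  \<open>q x\<close> below by \<open>- p (- x)\<close>; the infimum is subadditive because of two
  members of a chain the smaller one serves both arguments.\<close>

lemma sublinear_Inf_chain:
  assumes V: "vector_space sc" and C: "C \<noteq> {}" "\<And>q. q \<in> C \<Longrightarrow> sublinear sc q \<and> (\<forall>x. q x \<le> p x)"
    and chain: "\<And>q r. q \<in> C \<Longrightarrow> r \<in> C \<Longrightarrow> q \<le> r \<or> r \<le> q"
  shows "sublinear sc (\<lambda>x. INF q\<in>C. q x) \<and> (\<forall>q\<in>C. (\<lambda>x. INF q\<in>C. q x) \<le> q)"
proof -
  define i where "i = (\<lambda>x. INF q\<in>C. q x)"
  have bdd: "bdd_below ((\<lambda>q. q x) ` C)" for x
  proof (rule bdd_belowI2[where m = "- p (- x)"])
    fix q assume "q \<in> C"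
    then show "- p (- x) \<le> q x"
      using sublinear_ge_minus[OF V, of q x] C(2)[of q] by (meson neg_le_iff_le order_trans)
  qed
  have le: "i x \<le> q x" if "q \<in> C" for q x
    unfolding i_def by (rule cINF_lower[OF bdd that])
  have ge: "c \<le> i x" if "\<And>q. q \<in> C \<Longrightarrow> c \<le> q x" for c x
    unfolding i_def by (rule cINF_greatest[OF C(1) that])
  have add: "i (x + y) \<le> i x + i y" for x y
  proof -
    have "i (x + y) - q x \<le> r y" if qr: "q \<in> C" "r \<in> C" for q r
    proof -
      obtain m where m: "m \<in> C" "m \<le> q" "m \<le> r" using chain[OF qr] qr by blast
      have "i (x + y) \<le> m (x + y)" by (rule le[OF m(1)])
      also have "\<dots> \<le> m x + m y" using C(2)[OF m(1)] unfolding sublinear_def by blast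
      also have "\<dots> \<le> q x + r y" using m(2,3) by (intro add_mono) (auto dest: le_funD)
      finally show ?thesis by simp
    qed
    then have "i (x + y) - i y \<le> q x" if "q \<in> C" for q
      using ge[of "i (x + y) - q x" y] that by fastforce
    then have "i (x + y) - i y \<le> i x" by (rule ge)
    then show ?thesis by simp
  qed
  have "i (sc r x) = r * i x" if "r > 0" for r x
  proof -
    have eq: "q (sc r x) = r * q x" if "q \<in> C" for q
      using C(2)[OF that] \<open>r > 0\<close> unfolding sublinear_def by blast
    have "r * i x \<le> i (sc r x)"
      using le \<open>r > 0\<close> by (intro ge) (auto simp: eq)
    moreover have "i (sc r x) / r \<le> i x"
    proof (rule ge)
      fix q assume "q \<in> C"
      then show "i (sc r x) / r \<le> q x"
        using le[of q "sc r x"] eq[of q] \<open>r > 0\<close> by (simp add: field_simps)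
    qed
    ultimately show ?thesis using \<open>r > 0\<close> by (simp add: field_simps)
  qed
  then show ?thesis using add le unfolding sublinear_def i_def by (auto simp: le_fun_def)
qed

text \<open>A minimal sublinear functional is linear, since \<open>sublinear_descent\<close> cannot lower it;
  descending once from \<open>p\<close> in the direction \<open>x\<^sub>0\<close> before minimising enforces the
  value at \<open>x\<^sub>0\<close>.\<close>

theorem Hahn_Banach_sublinear:
  assumes V: "vector_space sc" and p: "sublinear sc p"
  obtains u where "Vector_Spaces.linear sc (*) u" "\<And>x. u x \<le> p x" "u x0 = p x0"
proof -
  interpret vector_space sc by fact
  obtain p' where p': "sublinear sc p'" "\<And>x. p' x \<le> p x" "p' (- x0) \<le> - p x0"
    using sublinear_descent[OF V p] by blast
  define A where "A = {q. sublinear sc q \<and> (\<forall>x. q x \<le> p' x)}"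
  \<comment> \<open>The order is reversed, so that the maximal element of Zorn's lemma is a minimal
    functional.\<close>
  let ?R = "\<lambda>q r :: 'a \<Rightarrow> real. r \<le> q"
  have "\<exists>m\<in>A. \<forall>a\<in>A. ?R m a \<longrightarrow> a = m"
  proof (rule predicate_Zorn)
    show "partial_order_on A (relation_of ?R A)"
      by (rule partial_order_on_relation_ofI) auto
    fix C assume C: "C \<in> Chains (relation_of ?R A)"
    show "\<exists>u\<in>A. \<forall>a\<in>C. ?R a u"
    proof (cases "C = {}")
      case True
      then show ?thesis using p' unfolding A_def by auto
    next
      case False
      have CA: "q \<in> A" if "q \<in> C" for q
        using C that unfolding Chains_def relation_of_def by auto
      have ch: "q \<le> r \<or> r \<le> q" if "q \<in> C" "r \<in> C" for q r
        using C that unfolding Chains_def relation_of_def by auto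
      have *: "sublinear sc (\<lambda>x. INF q\<in>C. q x) \<and> (\<forall>q\<in>C. (\<lambda>x. INF q\<in>C. q x) \<le> q)"
        by (rule sublinear_Inf_chain[OF V False _ ch, of p']) (use CA in \<open>auto simp: A_def\<close>)
      moreover have "(INF q\<in>C. q x) \<le> p' x" for x
      proof -
        obtain q where q: "q \<in> C" using False by blast
        then have "(INF q\<in>C. q x) \<le> q x" using * by (auto simp: le_fun_def)
        also have "\<dots> \<le> p' x" using CA[OF q] unfolding A_def by blast
        finally show ?thesis .
      qed
      ultimately show ?thesis
        by (intro bexI[of _ "\<lambda>x. INF q\<in>C. q x"]) (auto simp: A_def)
    qed
  qed
  then obtain m where m: "m \<in> A" and min: "\<And>a. a \<in> A \<Longrightarrow> a \<le> m \<Longrightarrow> a = m" by blast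
  have sm: "sublinear sc m" and mp: "\<And>x. m x \<le> p' x" using m unfolding A_def by auto
  have odd: "m (- y) = - m y" for y
  proof -
    obtain q where q: "sublinear sc q" "\<And>x. q x \<le> m x" "q (- y) \<le> - m y"
      using sublinear_descent[OF V sm] by blast
    have "q \<in> A" using q mp unfolding A_def by (auto intro: order_trans)
    then have "q = m" using q(2) by (intro min) (auto simp: le_fun_def)
    with q(3) sublinear_ge_minus[OF V sm, of y] show ?thesis by simp
  qed
  have sub: "m (u + v) \<le> m u + m v" for u v
    using sm unfolding sublinear_def by blast
  have add: "m (u + v) = m u + m v" for u v
    using sub[of u v] sub[of "u + v" "- v"] odd[of v] by simp
  have pos: "m (sc r u) = r * m u" if "r > 0" for r u
    using sm that unfolding sublinear_def by blast
  have scale: "m (sc r u) = r * m u" for r u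
  proof -
    consider "r > 0" | "r = 0" | "- r > 0" by linarith
    then show ?thesis
    proof cases
      case 3
      have "m (sc r u) = m (- sc (- r) u)" by simp
      also have "\<dots> = r * m u" using odd pos[OF 3, of u] by simp
      finally show ?thesis .
    qed (use pos sublinear_zero[OF V sm] in auto)
  qed
  have lin: "Vector_Spaces.linear sc (*) m"
    by unfold_locales (auto simp: add scale algebra_simps)
  moreover have "m x \<le> p x" for x using mp[of x] p'(2)[of x] by simp
  moreover have "m x0 = p x0"
    using mp[of "- x0"] p'(3) odd[of x0] mp[of x0] p'(2)[of x0] by simp
  ultimately show thesis by (rule that)
qed

section \<open>Seminorm topologies and their duals\<close>

text \<open>\<open>nonempty\<close> makes the balls cover the type, so that
  \<open>topspace \<tau>\<close> is everything.\<close>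

locale seminormed_space = vector_space smul
  for smul :: "'k::{real_normed_field,euclidean_space} \<Rightarrow> 'a::ab_group_add \<Rightarrow> 'a" +
  fixes P :: "('a \<Rightarrow> real) set"
  assumes seminorms: "p \<in> P \<Longrightarrow> seminorm smul p"
    and nonempty: "P \<noteq> {}"
begin

abbreviation \<tau> :: "'a topology" where "\<tau> \<equiv> seminorm_topology P"

abbreviation rmul :: "real \<Rightarrow> 'a \<Rightarrow> 'a" where "rmul r x \<equiv> smul (of_real r) x"

lemma seminorm_nonneg: "p \<in> P \<Longrightarrow> 0 \<le> p x"
  and seminorm_triangle: "p \<in> P \<Longrightarrow> p (x + y) \<le> p x + p y"
  and seminorm_smul: "p \<in> P \<Longrightarrow> p (smul c x) = norm c * p x"
  using seminorms unfolding seminorm_def by blast+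

lemma seminorm_rmul: "p \<in> P \<Longrightarrow> p (rmul r x) = \<bar>r\<bar> * p x"
  by (simp add: seminorm_smul)

lemma seminorm_zero: "p \<in> P \<Longrightarrow> p 0 = 0"
  using seminorm_smul[of p 0 0] by simp

lemma seminorm_minus: "p \<in> P \<Longrightarrow> p (- x) = p x"
  using seminorm_smul[of p "-1" x] by simp

lemma seminorm_diff_commute: "p \<in> P \<Longrightarrow> p (x - y) = p (y - x)"
  using seminorm_minus[of p "x - y"] by simp

lemma seminorm_diff: "p \<in> P \<Longrightarrow> p (x - y) \<le> p x + p y"
  using seminorm_triangle[of p x "- y"] by (simp add: seminorm_minus)

lemma seminorm_diff_triangle: "p \<in> P \<Longrightarrow> p (x - z) \<le> p (x - y) + p (y - z)"
  using seminorm_triangle[of p "x - y" "y - z"] by simp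

lemma seminorm_abs_diff: "p \<in> P \<Longrightarrow> \<bar>p x - p y\<bar> \<le> p (x - y)"
  using seminorm_triangle[of p "x - y" y] seminorm_triangle[of p "y - x" x]
  by (simp add: seminorm_diff_commute[of p y x])

lemma seminorm_sum: "p \<in> P \<Longrightarrow> p (sum g I) \<le> (\<Sum>i\<in>I. p (g i))"
proof (induction I rule: infinite_finite_induct)
  case (insert i I)
  then show ?case using seminorm_triangle[of p "g i" "sum g I"] by simp
qed (auto simp: seminorm_zero)

lemma topspace_\<tau> [simp]: "topspace \<tau> = UNIV"
proof -
  obtain p where p: "p \<in> P" using nonempty by blast
  have "x \<in> \<Union> {{y. p (y - x) < r} | p x r. p \<in> P \<and> 0 < r}" for x
    by (rule UnionI[of "{y. p (y - x) < 1}"])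
      (use p in \<open>auto simp: seminorm_zero[OF p] intro!: exI[of _ p] exI[of _ x] exI[of _ "1::real"]\<close>)
  then show ?thesis
    unfolding seminorm_topology_def topology_generated_by_topspace by blast
qed

lemma openin_seminorm_ball: "p \<in> P \<Longrightarrow> 0 < r \<Longrightarrow> openin \<tau> {y. p (y - x) < r}"
  unfolding seminorm_topology_def by (intro topology_generated_by_Basis) blast

text \<open>Turns topological limits along any filter into real limits. From right to left it is an
  induction over the generation of open sets; a subbasic ball around \<open>x\<close> is handled by
  the triangle inequality with slack \<open>r - p (l - x)\<close>.\<close>

lemma limitin_iff: "limitin \<tau> g l F \<longleftrightarrow> (\<forall>p\<in>P. ((\<lambda>i. p (g i - l)) \<longlongrightarrow> 0) F)"
proof
  assume lim: "limitin \<tau> g l F"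
  show "\<forall>p\<in>P. ((\<lambda>i. p (g i - l)) \<longlongrightarrow> 0) F"
  proof
    fix p assume p: "p \<in> P"
    show "((\<lambda>i. p (g i - l)) \<longlongrightarrow> 0) F"
    proof (rule order_tendstoI)
      fix a :: real assume "a < 0"
      then show "\<forall>\<^sub>F i in F. a < p (g i - l)"
        using seminorm_nonneg[OF p] by (intro always_eventually) (auto intro: less_le_trans)
    next
      fix r :: real assume "0 < r"
      then show "\<forall>\<^sub>F i in F. p (g i - l) < r"
        using limitinD[OF lim openin_seminorm_ball[OF p, of r l]]
        by (simp add: seminorm_zero[OF p])
    qed
  qed
next
  assume tend: "\<forall>p\<in>P. ((\<lambda>i. p (g i - l)) \<longlongrightarrow> 0) F"
  have "l \<in> U \<longrightarrow> (\<forall>\<^sub>F i in F. g i \<in> U)"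
    if "generate_topology_on {{y. p (y - x) < r} | p x r. p \<in> P \<and> 0 < r} U" for U
    using that
  proof induction
    case (Int a b)
    then show ?case by (auto intro: eventually_conj)
  next
    case (UN K)
    show ?case
    proof
      assume "l \<in> \<Union> K"
      then obtain k where "k \<in> K" "l \<in> k" by blast
      then show "\<forall>\<^sub>F i in F. g i \<in> \<Union> K" using UN.IH[of k] by (auto elim: eventually_mono)
    qed
  next
    case (Basis s)
    then obtain p x r where s: "s = {y. p (y - x) < r}" "p \<in> P" by blast
    show ?case
    proof
      assume "l \<in> s"
      then have "0 < r - p (l - x)" using s by simp
      then have "\<forall>\<^sub>F i in F. p (g i - l) < r - p (l - x)"
        using order_tendstoD(2) tend s(2) by blast
      then show "\<forall>\<^sub>F i in F. g i \<in> s"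
      proof eventually_elim
        case (elim i)
        then show ?case using seminorm_diff_triangle[OF s(2), of "g i" x l] s(1) by simp
      qed
    qed
  qed auto
  then have "\<forall>U. openin \<tau> U \<and> l \<in> U \<longrightarrow> (\<forall>\<^sub>F i in F. g i \<in> U)"
    unfolding seminorm_topology_def by (blast dest: openin_topology_generated_by)
  then show "limitin \<tau> g l F" unfolding limitin_def by simp
qed

lemma continuous_map_iff:
  fixes h :: "'b::topological_space \<Rightarrow> 'a"
  shows "continuous_map euclidean \<tau> h \<longleftrightarrow> (\<forall>s. limitin \<tau> h (h s) (at s))"
proof -
  have "atin euclidean s = at s" for s :: 'b
    by (auto simp: filter_eq_iff eventually_atin eventually_at_topological)
  then show ?thesis by (simp add: continuous_map_atin)
qed

lemma limitin_add:
  assumes "limitin \<tau> g l F" "limitin \<tau> h m F"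
  shows "limitin \<tau> (\<lambda>i. g i + h i) (l + m) F"
  unfolding limitin_iff
proof
  fix p assume p: "p \<in> P"
  show "((\<lambda>i. p (g i + h i - (l + m))) \<longlongrightarrow> 0) F"
  proof (rule tendsto_sandwich[OF _ _ tendsto_const])
    show "((\<lambda>i. p (g i - l) + p (h i - m)) \<longlongrightarrow> 0) F"
      using assms p unfolding limitin_iff by (auto intro: tendsto_add_zero)
    show "\<forall>\<^sub>F i in F. p (g i + h i - (l + m)) \<le> p (g i - l) + p (h i - m)"
      using seminorm_triangle[OF p, of "g i - l" "h i - m" for i]
      by (intro always_eventually) (simp add: algebra_simps)
  qed (simp add: seminorm_nonneg p)
qed

lemma limitin_smul:
  assumes "(c \<longlongrightarrow> d) F" "limitin \<tau> g l F"
  shows "limitin \<tau> (\<lambda>i. smul (c i) (g i)) (smul d l) F"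
  unfolding limitin_iff
proof
  fix p assume p: "p \<in> P"
  show "((\<lambda>i. p (smul (c i) (g i) - smul d l)) \<longlongrightarrow> 0) F"
  proof (rule tendsto_sandwich[OF _ _ tendsto_const])
    have "((\<lambda>i. norm (c i) * p (g i - l) + norm (c i - d) * p l) \<longlongrightarrow> norm d * 0 + 0 * p l) F"
      using assms p unfolding limitin_iff
      by (intro tendsto_intros) (auto intro: tendsto_norm_zero LIM_zero)
    then show "((\<lambda>i. norm (c i) * p (g i - l) + norm (c i - d) * p l) \<longlongrightarrow> 0) F" by simp
    have "smul (c i) (g i) - smul d l = smul (c i) (g i - l) + smul (c i - d) l" for i
      by (simp add: scale_right_diff_distrib scale_left_diff_distrib)
    then show "\<forall>\<^sub>F i in F. p (smul (c i) (g i) - smul d l)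
        \<le> norm (c i) * p (g i - l) + norm (c i - d) * p l"
      using seminorm_triangle[OF p, of "smul (c i) (g i - l)" "smul (c i - d) l" for i]
      by (simp add: seminorm_smul p)
  qed (simp add: seminorm_nonneg p)
qed

lemma limitin_const': "limitin \<tau> (\<lambda>_. l) l F"
  by (simp add: limitin_const_iff)

lemma limitin_diff:
  assumes "limitin \<tau> g l F" "limitin \<tau> h m F"
  shows "limitin \<tau> (\<lambda>i. g i - h i) (l - m) F"
  using limitin_add[OF assms(1) limitin_smul[OF tendsto_const[of "-1"] assms(2)]] by simp

lemma limitin_sum:
  assumes "\<And>i. i \<in> I \<Longrightarrow> limitin \<tau> (g i) (l i) F"
  shows "limitin \<tau> (\<lambda>x. \<Sum>i\<in>I. g i x) (\<Sum>i\<in>I. l i) F"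
  using assms
  by (induction I rule: infinite_finite_induct) (auto intro: limitin_add)

lemma tendsto_seminorm:
  assumes "p \<in> P" "limitin \<tau> g l F"
  shows "((\<lambda>i. p (g i)) \<longlongrightarrow> p l) F"
proof (rule LIM_zero_cancel, rule Lim_null_comparison)
  show "((\<lambda>i. p (g i - l)) \<longlongrightarrow> 0) F" using assms unfolding limitin_iff by blast
qed (simp add: seminorm_abs_diff assms)

lemma continuous_on_seminorm:
  fixes h :: "'b::topological_space \<Rightarrow> 'a"
  assumes "p \<in> P" "continuous_map euclidean \<tau> h"
  shows "continuous_on UNIV (\<lambda>s. p (h s))"
  unfolding continuous_on_def
  using assms(2) by (auto simp: continuous_map_iff intro!: tendsto_seminorm[OF assms(1)])

section \<open>Continuous linear functionals and norming functionals\<close>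

lemma dual_linear: "x' \<in> continuous_dual smul P \<Longrightarrow> Vector_Spaces.linear smul (*) x'"
  unfolding continuous_dual_def by blast

lemma dual_limit:
  assumes "x' \<in> continuous_dual smul P" "limitin \<tau> g l F"
  shows "((\<lambda>i. x' (g i)) \<longlongrightarrow> x' l) F"
proof (rule topological_tendstoI)
  fix U assume "open U" "x' l \<in> U"
  then have "openin \<tau> {x. x' x \<in> U}" "l \<in> {x. x' x \<in> U}"
    using assms(1) by (auto simp: continuous_dual_def continuous_map_def)
  from limitinD[OF assms(2) this] show "\<forall>\<^sub>F i in F. x' (g i) \<in> U" by simp
qed

lemma continuous_on_dual:
  fixes h :: "'b::topological_space \<Rightarrow> 'a"
  assumes "x' \<in> continuous_dual smul P" "continuous_map euclidean \<tau> h"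
  shows "continuous_on UNIV (\<lambda>s. x' (h s))"
  unfolding continuous_on_def
  using assms(2) by (auto simp: continuous_map_iff intro!: dual_limit[OF assms(1)])

text \<open>Otherwise some \<open>g n\<close> in \<open>B\<close> have values of norm above
  \<open>n + 1\<close>; divided by \<open>n + 1\<close> they tend to 0 because \<open>B\<close> is
  bounded, while their values keep norm above 1.\<close>

lemma dual_bounded:
  assumes "x' \<in> continuous_dual smul P" "seminorm_bounded P B"
  obtains C where "\<And>x. x \<in> B \<Longrightarrow> norm (x' x) \<le> C"
proof (rule ccontr)
  interpret Vector_Spaces.linear smul "(*)" x' using assms(1) by (rule dual_linear)
  assume "\<not> thesis"
  then have "\<exists>x\<in>B. real (Suc n) < norm (x' x)" for n
    using that[of "real (Suc n)"] not_less by blast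
  then obtain g where g: "\<And>n. g n \<in> B" "\<And>n. real (Suc n) < norm (x' (g n))" by metis
  have "limitin \<tau> (\<lambda>n. rmul (inverse (real (Suc n))) (g n)) 0 sequentially"
    unfolding limitin_iff
  proof
    fix p assume p: "p \<in> P"
    obtain C where C: "\<And>x. x \<in> B \<Longrightarrow> p x \<le> C"
      using assms(2) p unfolding seminorm_bounded_def by blast
    show "(\<lambda>n. p (rmul (inverse (real (Suc n))) (g n) - 0)) \<longlonglongrightarrow> 0"
    proof (rule Lim_null_comparison)
      show "(\<lambda>n. inverse (real (Suc n)) * C) \<longlonglongrightarrow> 0"
        by (intro tendsto_mult_left_zero LIMSEQ_inverse_real_of_nat)
      show "\<forall>\<^sub>F n in sequentially. norm (p (rmul (inverse (real (Suc n))) (g n) - 0))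
          \<le> inverse (real (Suc n)) * C"
        using C[OF g(1)] seminorm_nonneg[OF p]
        by (intro always_eventually) (simp add: seminorm_rmul p mult_left_mono del: of_nat_Suc of_real_inverse)
    qed
  qed
  from dual_limit[OF assms(1) this]
  have "(\<lambda>n. norm (of_real (inverse (real (Suc n))) * x' (g n))) \<longlonglongrightarrow> 0"
    using tendsto_norm_zero by (fastforce simp: scale zero)
  then have "\<forall>\<^sub>F n in sequentially. norm (of_real (inverse (real (Suc n))) * x' (g n)) < 1"
    by (rule order_tendstoD) simp
  then obtain n where "norm (of_real (inverse (real (Suc n))) * x' (g n)) < 1"
    by (auto simp: eventually_sequentially simp del: of_real_inverse of_nat_Suc)
  then have "norm (x' (g n)) < real (Suc n)"
    by (simp add: norm_mult field_simps norm_divide del: of_nat_Suc of_real_inverse)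
  then show False using g(2)[of n] by simp
qed

text \<open>Instead of distinguishing the real and the complex field: the bilinear form
  \<open>(c, d) \<mapsto> (c * d) \<bullet> 1\<close> on the field is nondegenerate, so every real-linear functional \<open>u\<close> is of
  the form \<open>u x = x' x \<bullet> 1\<close> for a unique linear \<open>x'\<close>.\<close>

lemma real_functional_lift:
  fixes u :: "'a \<Rightarrow> real"
  assumes u: "Vector_Spaces.linear rmul (*) u" and p: "p \<in> P" and le: "\<And>x. u x \<le> p x"
  obtains x' where "x' \<in> continuous_dual smul P" "\<And>x. u x = x' x \<bullet> (1::'k)"
proof -
  interpret u: Vector_Spaces.linear rmul "(*)" u by fact
  have ule: "\<bar>u x\<bar> \<le> p x" for x
    using le[of x] le[of "- x"] u.neg[of x] by (simp add: seminorm_minus p)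
  \<comment> \<open>\<open>\<Phi> g\<close> is the vector that represents the real functional
    sending \<open>c\<close> to \<open>(c * g) \<bullet> 1\<close>.\<close>
  define \<Phi> :: "'k \<Rightarrow> 'k" where "\<Phi> g = (\<Sum>e\<in>Basis. ((e * g) \<bullet> 1) *\<^sub>R e)" for g
  have \<Phi>: "c \<bullet> \<Phi> g = (c * g) \<bullet> 1" for c g
  proof -
    have "(c * g) \<bullet> 1 = ((\<Sum>e\<in>Basis. (c \<bullet> e) *\<^sub>R e) * g) \<bullet> 1" by (simp add: euclidean_representation)
    also have "\<dots> = (\<Sum>e\<in>Basis. (c \<bullet> e) * ((e * g) \<bullet> 1))"
      by (simp add: sum_distrib_right inner_sum_left)
    also have "\<dots> = c \<bullet> \<Phi> g" unfolding \<Phi>_def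
      by (simp add: inner_sum_right mult.commute)
    finally show ?thesis by simp
  qed
  have lin: "Real_Vector_Spaces.linear \<Phi>"
    unfolding \<Phi>_def
    by (intro Real_Vector_Spaces.linear_compose_sum linearI ballI)
      (auto simp: inner_left_distrib scaleR_left_distrib distrib_left)
  have inj: "inj \<Phi>"
    unfolding linear_injective_0[OF lin]
  proof (intro allI impI)
    fix g assume "\<Phi> g = 0"
    then have "(c * g) \<bullet> 1 = 0" for c using \<Phi>[of c g] by simp
    from this[of "inverse g"] show "g = 0" by (cases "g = 0") auto
  qed
  obtain \<Psi> where \<Psi>: "Real_Vector_Spaces.linear \<Psi>" "\<And>g. \<Phi> (\<Psi> g) = g"
    using linear_injective_isomorphism[OF lin inj] by metis
  \<comment> \<open>Likewise \<open>w x\<close> represents the functional sending \<open>c\<close>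
    to \<open>u (smul c x)\<close>; solving \<open>\<Phi> g = w x\<close> for \<open>g\<close>
    yields \<open>x' x\<close>.\<close>
  define w where "w x = (\<Sum>e\<in>Basis. u (smul e x) *\<^sub>R e)" for x
  have rs: "smul (r *\<^sub>R c) x = rmul r (smul c x)" for r c x
    by (simp add: scaleR_conv_of_real)
  have w: "c \<bullet> w x = u (smul c x)" for c x
  proof -
    have "u (smul c x) = u (smul (\<Sum>e\<in>Basis. (c \<bullet> e) *\<^sub>R e) x)" by (simp add: euclidean_representation)
    also have "\<dots> = (\<Sum>e\<in>Basis. (c \<bullet> e) * u (smul e x))"
      by (simp only: scale_sum_left u.sum rs u.scale)
    finally show ?thesis unfolding w_def by (simp add: inner_sum_right mult.commute)
  qed
  define x' where "x' x = \<Psi> (w x)" for x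
  have key: "(c * x' x) \<bullet> 1 = u (smul c x)" for c x
    using \<Phi>[of c "x' x"] by (simp add: x'_def \<Psi>(2) w)
  have eqI: "g = h" if "\<And>c. (c * g) \<bullet> 1 = (c * h) \<bullet> 1" for g h :: 'k
  proof -
    have "\<forall>c. c \<bullet> \<Phi> g = c \<bullet> \<Phi> h" using that \<Phi> by simp
    then have "\<Phi> g = \<Phi> h" by (simp only: vector_eq_ldot)
    then show ?thesis using inj by (auto dest: injD)
  qed
  have x'_add: "x' (x + y) = x' x + x' y" for x y
    by (rule eqI) (simp add: distrib_left inner_left_distrib key scale_right_distrib u.add)
  have x'_scale: "x' (smul d x) = d * x' x" for d x
    by (rule eqI) (simp add: key flip: mult.assoc)
  have linx': "Vector_Spaces.linear smul (*) x'"
    by unfold_locales (auto simp: x'_add x'_scale algebra_simps)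
  then interpret x': Vector_Spaces.linear smul "(*)" x' .
  obtain B where B: "\<And>g. norm (\<Psi> g) \<le> B * norm g"
    using linear_bounded[OF \<Psi>(1)] by blast
  have B0: "0 \<le> B" using order_trans[OF norm_ge_zero B[of 1]] by simp
  have bound: "norm (x' x) \<le> B * (\<Sum>e\<in>(Basis::'k set). p (smul e x))" for x
  proof -
    have "norm (w x) \<le> (\<Sum>e\<in>(Basis::'k set). norm (u (smul e x) *\<^sub>R e))"
      unfolding w_def by (rule norm_sum)
    also have "\<dots> \<le> (\<Sum>e\<in>(Basis::'k set). p (smul e x))"
      by (intro sum_mono) (simp add: ule)
    finally show ?thesis
      unfolding x'_def using B[of "w x"] B0 by (meson mult_left_mono order_trans)
  qed
  have bound': "norm (x' x) \<le> B * real DIM('k) * p x" for x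
    using bound[of x] by (simp add: seminorm_smul p)
  have "continuous_map \<tau> euclidean x'"
  proof (subst continuous_map_atin, intro ballI)
    fix x
    have id: "limitin \<tau> (\<lambda>y. y) x (atin \<tau> x)"
      using continuous_map_id[of \<tau>] unfolding continuous_map_atin id_def by simp
    have "((\<lambda>y. x' y - x' x) \<longlongrightarrow> 0) (atin \<tau> x)"
    proof (rule Lim_null_comparison)
      show "((\<lambda>y. B * real DIM('k) * p (y - x)) \<longlongrightarrow> 0) (atin \<tau> x)"
        using id p unfolding limitin_iff by (auto intro: tendsto_mult_right_zero)
      show "\<forall>\<^sub>F y in atin \<tau> x. norm (x' y - x' x) \<le> B * real DIM('k) * p (y - x)"
        using bound' by (simp flip: x'.diff)
    qed
    then show "limitin euclidean x' (x' x) (atin \<tau> x)" by (simp add: LIM_zero_iff)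
  qed
  then have "x' \<in> continuous_dual smul P"
    using linx' unfolding continuous_dual_def by blast
  moreover have "u x = x' x \<bullet> 1" for x using key[of 1 x] by simp
  ultimately show thesis by (rule that)
qed

text \<open>Hahn-Banach over the reals gives \<open>u \<le> p\<close> with equality at
  \<open>x0\<close>, and the lift makes \<open>u\<close> the \<open>\<bullet> 1\<close> part of a
  continuous functional over the field. Such functionals let scalar information about Pettis
  integrals control \<open>p\<close>.\<close>

lemma supporting_functional:
  assumes p: "p \<in> P"
  obtains x' where "x' \<in> continuous_dual smul P" "\<And>x. x' x \<bullet> (1::'k) \<le> p x" "x' x0 \<bullet> 1 = p x0"
proof -
  have V: "vector_space rmul"
    by unfold_locales (auto simp: scale_left_distrib scale_right_distrib)
  have "sublinear rmul p"
    unfolding sublinear_def using seminorm_triangle[OF p] by (simp add: seminorm_smul p)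
  from Hahn_Banach_sublinear[OF V this, of x0] obtain u
    where u: "Vector_Spaces.linear rmul (*) u" "\<And>x. u x \<le> p x" "u x0 = p x0" by blast
  from real_functional_lift[OF u(1) p u(2)] obtain x'
    where "x' \<in> continuous_dual smul P" "\<And>x. u x = x' x \<bullet> (1::'k)" by blast
  then show thesis using u(2,3) by (intro that[of x']) auto
qed

text \<open>Test with a functional that attains \<open>p\<close> at \<open>x\<close>: taking
  \<open>\<bullet> 1\<close> commutes with the integral, and the integrand is then at most
  \<open>p (g w)\<close>.\<close>

lemma Pettis_seminorm_le:
  assumes p: "p \<in> P" and g: "has_Pettis_integral smul P M \<Omega> g x"
    and int: "set_integrable M \<Omega> (\<lambda>w. p (g w))"
  shows "p x \<le> (LINT w:\<Omega>|M. p (g w))"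
proof -
  obtain x' where x': "x' \<in> continuous_dual smul P" "\<And>y. x' y \<bullet> (1::'k) \<le> p y" "x' x \<bullet> 1 = p x"
    using supporting_functional[OF p] by blast
  have int': "set_integrable M \<Omega> (\<lambda>w. x' (g w))" and eq: "x' x = (LINT w:\<Omega>|M. x' (g w))"
    using g x'(1) unfolding has_Pettis_integral_def by auto
  have int1: "set_integrable M \<Omega> (\<lambda>w. x' (g w) \<bullet> 1)"
    using integrable_inner_left[of "1::'k", OF int'[unfolded set_integrable_def]]
    by (simp add: set_integrable_def)
  have "p x = (LINT w:\<Omega>|M. x' (g w)) \<bullet> 1" using x'(3) eq by simp
  also have "\<dots> = (LINT w:\<Omega>|M. x' (g w) \<bullet> 1)"
    using integral_inner_left[of "1::'k", OF int'[unfolded set_integrable_def]]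
    by (simp add: set_lebesgue_integral_def)
  also have "\<dots> \<le> (LINT w:\<Omega>|M. p (g w))"
    by (rule set_integral_mono[OF int1 int x'(2)])
  finally show ?thesis .
qed

end

locale Hausdorff_seminormed_space = seminormed_space +
  assumes Hausdorff: "Hausdorff_space \<tau>"
begin

lemma eq_zeroI:
  assumes "\<And>p. p \<in> P \<Longrightarrow> p x = 0"
  shows "x = 0"
proof (rule limitin_Hausdorff_unique)
  show "limitin \<tau> (\<lambda>_. 0) x sequentially"
    unfolding limitin_iff by (simp add: assms seminorm_minus)
  show "limitin \<tau> (\<lambda>_. 0) 0 sequentially" by (rule limitin_const')
qed (simp_all add: Hausdorff)

text \<open>Uniqueness behind the \<open>THE\<close>: a functional attaining \<open>p\<close> at
  \<open>y - x\<close> vanishes there, for every \<open>p\<close>, and the space is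
  Hausdorff.\<close>

lemma Pettis_integral_eq:
  assumes x: "has_Pettis_integral smul P M \<Omega> g x"
  shows "Pettis_integral smul P M \<Omega> g = x"
  unfolding Pettis_integral_def
proof (rule the_equality)
  fix y assume y: "has_Pettis_integral smul P M \<Omega> g y"
  have "y - x = 0"
  proof (rule eq_zeroI)
    fix p assume "p \<in> P"
    then obtain x' where x': "x' \<in> continuous_dual smul P" "x' (y - x) \<bullet> (1::'a) = p (y - x)"
      using supporting_functional by blast
    interpret Vector_Spaces.linear smul "(*)" x' using x'(1) by (rule dual_linear)
    show "p (y - x) = 0"
      using x y x' unfolding has_Pettis_integral_def by (metis diff diff_self inner_zero_left)
  qed
  then show "y = x" by simp
qed fact

end

section \<open>Bernstein approximation on the half line\<close>

text \<open>This is the variance of a binomial variable divided by \<open>n\<close> squared. The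
  square is expanded into \<open>k * (k - 1)\<close>, \<open>k\<close> and 1, whose Bernstein means
  are known.\<close>

lemma sum_square_Bernstein:
  assumes "n > 0"
  shows "(\<Sum>k\<le>n. Bernstein n k z * (real k / real n - z)\<^sup>2) = z * (1 - z) / real n"
proof -
  have "(\<Sum>k\<le>n. Bernstein n k z * (real k / real n - z)\<^sup>2)
      = (\<Sum>k\<le>n. (real k * (real k - 1) * Bernstein n k z
          + (1 - 2 * real n * z) * (real k * Bernstein n k z)
          + (real n * z)\<^sup>2 * Bernstein n k z) / (real n)\<^sup>2)"
    using assms by (intro sum.cong refl) (simp add: field_simps power2_eq_square)
  also have "\<dots> = (real n * (real n - 1) * z\<^sup>2 + (1 - 2 * real n * z) * (real n * z)
      + (real n * z)\<^sup>2) / (real n)\<^sup>2"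
    by (simp add: sum.distrib flip: sum_divide_distrib sum_distrib_left)
  also have "\<dots> = z * (1 - z) / real n"
    using assms by (simp add: field_simps power2_eq_square)
  finally show ?thesis .
qed

text \<open>Unlike the uniform Bernstein--Weierstrass theorem, this needs continuity at one point only.\<close>

lemma Bernstein_tendsto_zero:
  fixes g :: "real \<Rightarrow> real"
  assumes z: "0 \<le> z" "z \<le> 1" and C: "\<And>x. 0 \<le> x \<Longrightarrow> x \<le> 1 \<Longrightarrow> \<bar>g x\<bar> \<le> C"
    and g: "isCont g z" "g z = 0"
  shows "(\<lambda>n. \<Sum>k\<le>n. Bernstein n k z * g (real k / real n)) \<longlonglongrightarrow> 0"
proof (rule LIMSEQ_I)
  fix e :: real assume "0 < e"
  then obtain d where d: "d > 0" "\<And>x. \<bar>x - z\<bar> < d \<Longrightarrow> \<bar>g x\<bar> < e / 2"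
    using g unfolding continuous_at_eps_delta dist_real_def by (metis diff_zero half_gt_zero)
  have C0: "0 \<le> C" using C[of 0] by simp
  \<comment> \<open>Chebyshev's argument: beyond distance \<open>d\<close> from \<open>z\<close> the
    quadratic term alone exceeds \<open>C\<close>, and its Bernstein mean is of order
    \<open>1 / n\<close>.\<close>
  have bound: "\<bar>g x\<bar> \<le> e / 2 + C / d\<^sup>2 * (x - z)\<^sup>2" if "0 \<le> x" "x \<le> 1" for x
  proof (cases "\<bar>x - z\<bar> < d")
    case True
    then show ?thesis using d C0 by (meson add_increasing2 divide_nonneg_nonneg less_imp_le
          mult_nonneg_nonneg zero_le_power2)
  next
    case False
    then have "d\<^sup>2 \<le> (x - z)\<^sup>2" using d(1) by (metis abs_le_square_iff abs_of_pos not_less)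
    then have "C \<le> C / d\<^sup>2 * (x - z)\<^sup>2"
      using d(1) C0 by (simp add: field_simps mult_left_mono)
    then show ?thesis using C[OF that] \<open>0 < e\<close> by simp
  qed
  obtain m where m: "real m > 2 * C / (d\<^sup>2 * e)" using reals_Archimedean2 by blast
  show "\<exists>N. \<forall>n\<ge>N. norm ((\<Sum>k\<le>n. Bernstein n k z * g (real k / real n)) - 0) < e"
  proof (intro exI allI impI)
    fix n assume n: "n \<ge> Suc m"
    then have n0: "n > 0" by simp
    have B: "0 \<le> Bernstein n k z" for k using z by (rule Bernstein_nonneg)
    have "norm ((\<Sum>k\<le>n. Bernstein n k z * g (real k / real n)) - 0)
        \<le> (\<Sum>k\<le>n. \<bar>Bernstein n k z * g (real k / real n)\<bar>)"
      by (simp add: sum_abs)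
    also have "\<dots> \<le> (\<Sum>k\<le>n. Bernstein n k z * (e / 2 + C / d\<^sup>2 * (real k / real n - z)\<^sup>2))"
    proof (rule sum_mono)
      fix k assume "k \<in> {..n}"
      then have "0 \<le> real k / real n" "real k / real n \<le> 1" using n0 by auto
      from bound[OF this]
      show "\<bar>Bernstein n k z * g (real k / real n)\<bar>
          \<le> Bernstein n k z * (e / 2 + C / d\<^sup>2 * (real k / real n - z)\<^sup>2)"
        using B[of k] by (simp add: abs_mult mult_left_mono)
    qed
    also have "\<dots> = (\<Sum>k\<le>n. e / 2 * Bernstein n k z
        + C / d\<^sup>2 * (Bernstein n k z * (real k / real n - z)\<^sup>2))"
      by (intro sum.cong refl) (simp add: algebra_simps)
    also have "\<dots> = e / 2 + C / d\<^sup>2 * (z * (1 - z) / real n)"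
      by (simp only: sum.distrib sum_square_Bernstein[OF n0] sum_Bernstein mult_1_right
          flip: sum_distrib_left)
    also have "\<dots> < e"
    proof -
      have "z * (1 - z) \<le> 1 * 1" using z by (intro mult_mono) auto
      then have "C / d\<^sup>2 * (z * (1 - z) / real n) \<le> C / d\<^sup>2 * (1 / real n)"
        using C0 by (intro mult_left_mono divide_right_mono) auto
      also have "\<dots> < e / 2"
      proof -
        have "2 * C / (d\<^sup>2 * e) < real n" using m n by linarith
        then show ?thesis using d(1) \<open>0 < e\<close> n0 by (simp add: field_simps)
      qed
      finally show ?thesis by linarith
    qed
    finally show "norm ((\<Sum>k\<le>n. Bernstein n k z * g (real k / real n)) - 0) < e" .
  qed
qed

context seminormed_space
begin

text \<open>Bernstein polynomials in the variable \<open>exp (- s)\<close>. The node for \<open>k = 0\<close>, which is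
  \<open>s = \<infinity>\<close>, becomes \<open>s = 0\<close> because of \<open>ln 0 = 0\<close>; its weight tends to 0 pointwise.\<close>

definition Bernstein_exp :: "nat \<Rightarrow> (real \<Rightarrow> 'a) \<Rightarrow> real \<Rightarrow> 'a" where
  "Bernstein_exp n h s = (\<Sum>k\<le>n. rmul (Bernstein n k (exp (- s))) (h (- ln (real k / real n))))"

lemma seminorm_bounded_halfline:
  fixes h :: "real \<Rightarrow> 'a"
  assumes "seminorm_bounded P (h ` {0..})" "p \<in> P"
  obtains C where "\<And>s. 0 \<le> s \<Longrightarrow> p (h s) \<le> C"
proof -
  obtain C where "\<forall>x\<in>h ` {0..}. p x \<le> C" using assms unfolding seminorm_bounded_def by blast
  then show thesis by (intro that[of C]) simp
qed

lemma Bernstein_node_nonneg: "k \<le> n \<Longrightarrow> 0 \<le> - ln (real k / real n)"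
  by (cases "k = 0") (auto simp: divide_le_eq_1)

lemma Bernstein_exp_weight_nonneg: "0 \<le> s \<Longrightarrow> 0 \<le> Bernstein n k (exp (- s))"
  by (intro Bernstein_nonneg) auto

text \<open>The weights are nonnegative and sum to 1, so \<open>x\<close> is its own Bernstein mean
  and the estimate is convexity of \<open>p\<close>. The case \<open>x = 0\<close> gives
  boundedness, the case \<open>x = h s\<close> convergence.\<close>

lemma seminorm_Bernstein_exp_diff_le:
  assumes p: "p \<in> P" and s: "0 \<le> s"
  shows "p (Bernstein_exp n h s - x)
    \<le> (\<Sum>k\<le>n. Bernstein n k (exp (- s)) * p (h (- ln (real k / real n)) - x))"
proof -
  have "x = rmul (\<Sum>k\<le>n. Bernstein n k (exp (- s))) x" by simp
  also have "\<dots> = (\<Sum>k\<le>n. rmul (Bernstein n k (exp (- s))) x)"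
    by (simp only: of_real_sum scale_sum_left)
  finally have "Bernstein_exp n h s - x
      = (\<Sum>k\<le>n. rmul (Bernstein n k (exp (- s))) (h (- ln (real k / real n)) - x))"
    unfolding Bernstein_exp_def by (simp add: scale_right_diff_distrib sum_subtractf)
  also have "p \<dots> \<le> (\<Sum>k\<le>n. p (rmul (Bernstein n k (exp (- s))) (h (- ln (real k / real n)) - x)))"
    by (rule seminorm_sum[OF p])
  also have "\<dots> = (\<Sum>k\<le>n. Bernstein n k (exp (- s)) * p (h (- ln (real k / real n)) - x))"
    using Bernstein_exp_weight_nonneg[OF s] by (simp add: seminorm_rmul p)
  finally show ?thesis .
qed

lemma seminorm_Bernstein_exp_le:
  assumes p: "p \<in> P" and s: "0 \<le> s" and C: "\<And>s. 0 \<le> s \<Longrightarrow> p (h s) \<le> C"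
  shows "p (Bernstein_exp n h s) \<le> C"
proof -
  have "p (Bernstein_exp n h s)
      \<le> (\<Sum>k\<le>n. Bernstein n k (exp (- s)) * p (h (- ln (real k / real n))))"
    using seminorm_Bernstein_exp_diff_le[OF p s, of n h 0] by simp
  also have "\<dots> \<le> (\<Sum>k\<le>n. Bernstein n k (exp (- s)) * C)"
    by (intro sum_mono mult_left_mono C Bernstein_node_nonneg Bernstein_exp_weight_nonneg s) simp
  finally show ?thesis by (simp flip: sum_distrib_right)
qed

lemma continuous_map_Bernstein_exp: "continuous_map euclidean \<tau> (Bernstein_exp n h)"
  unfolding continuous_map_iff Bernstein_exp_def Bernstein_def
  by (intro allI limitin_sum limitin_smul limitin_const' tendsto_intros)

text \<open>The scalar lemma is applied to \<open>p (h (- ln x) - h s)\<close> at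
  \<open>exp (- s)\<close>. This point is positive, so the function is continuous there, whatever
  happens at \<open>x = 0\<close>, which stands for \<open>s = \<infinity>\<close>.\<close>

lemma limitin_Bernstein_exp:
  assumes h: "continuous_map euclidean \<tau> h" "seminorm_bounded P (h ` {0..})" and s: "0 \<le> s"
  shows "limitin \<tau> (\<lambda>n. Bernstein_exp n h s) (h s) sequentially"
  unfolding limitin_iff
proof
  fix p assume p: "p \<in> P"
  obtain C where C: "\<And>s. 0 \<le> s \<Longrightarrow> p (h s) \<le> C"
    using seminorm_bounded_halfline[OF h(2) p] by blast
  define g where "g x = p (h (- ln x) - h s)" for x
  have "(\<lambda>n. \<Sum>k\<le>n. Bernstein n k (exp (- s)) * g (real k / real n)) \<longlonglongrightarrow> 0"
  proof (rule Bernstein_tendsto_zero)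
    show "\<bar>g x\<bar> \<le> C + C" if "0 \<le> x" "x \<le> 1" for x
    proof -
      have "0 \<le> - ln x" using that by (cases "x = 0") auto
      then show ?thesis
        using seminorm_diff[OF p, of "h (- ln x)" "h s"] C[of "- ln x"] C[OF s]
          seminorm_nonneg[OF p, of "h (- ln x) - h s"]
        by (simp add: g_def)
    qed
    have "isCont (\<lambda>r. p (h r - h s)) s"
    proof -
      have "limitin \<tau> (\<lambda>r. h r - h s) (h s - h s) (at s)"
        using h(1) by (intro limitin_diff limitin_const') (simp add: continuous_map_iff)
      from tendsto_seminorm[OF p this] show ?thesis by (simp add: isCont_def)
    qed
    then have "isCont (\<lambda>r. p (h r - h s)) (- ln (exp (- s)))" by simp
    moreover have "isCont (\<lambda>x. - ln x) (exp (- s))" by (intro continuous_intros) auto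
    ultimately show "isCont g (exp (- s))"
      unfolding g_def by (rule isCont_o2[rotated])
    show "g (exp (- s)) = 0" by (simp add: g_def seminorm_zero p)
  qed (use s in auto)
  then show "(\<lambda>n. p (Bernstein_exp n h s - h s)) \<longlonglongrightarrow> 0"
  proof (rule Lim_null_comparison[rotated])
    show "\<forall>\<^sub>F n in sequentially. norm (p (Bernstein_exp n h s - h s))
        \<le> (\<Sum>k\<le>n. Bernstein n k (exp (- s)) * g (real k / real n))"
      using seminorm_Bernstein_exp_diff_le[OF p s]
      by (intro always_eventually) (simp add: g_def seminorm_nonneg p)
  qed
qed

end

section \<open>Existence of Pettis integrals\<close>

text \<open>Concentration on the half line is required almost everywhere, so that integrals run over
  the whole line without indicators.\<close>

locale halfline_measure = finite_measure M for M :: "real measure" +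
  assumes sets_M [measurable_cong, simp]: "sets M = sets borel"
    and AE_nonneg: "AE s in M. 0 \<le> s"
begin

lemma integrable_bounded:
  fixes f :: "real \<Rightarrow> 'b::{banach,second_countable_topology}"
  assumes "f \<in> borel_measurable borel" "\<And>s. 0 \<le> s \<Longrightarrow> norm (f s) \<le> C"
  shows "integrable M f"
proof (rule integrable_const_bound)
  show "AE s in M. norm (f s) \<le> C" using AE_nonneg by eventually_elim (rule assms(2))
  show "f \<in> borel_measurable M" using assms(1) by simp
qed

lemma integrable_exp: "0 \<le> l \<Longrightarrow> integrable M (\<lambda>s. exp (- (l * s)))"
  by (rule integrable_bounded[where C = 1]) auto

lemma integral_abs_le:
  fixes f g :: "real \<Rightarrow> real"
  assumes "integrable M f" "integrable M g" "\<And>s. 0 \<le> s \<Longrightarrow> \<bar>f s\<bar> \<le> g s"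
  shows "\<bar>integral\<^sup>L M f\<bar> \<le> integral\<^sup>L M g"
proof -
  have "\<bar>integral\<^sup>L M f\<bar> \<le> (LINT s|M. \<bar>f s\<bar>)" by (rule integral_abs_bound)
  also have "\<dots> \<le> integral\<^sup>L M g"
  proof (rule integral_mono_AE)
    show "AE s in M. \<bar>f s\<bar> \<le> g s" using AE_nonneg by eventually_elim (rule assms(3))
  qed (use assms in auto)
  finally show ?thesis .
qed

end

section \<open>Algebra of Pettis integrals and integrals of Bernstein polynomials\<close>

context seminormed_space
begin

lemma has_Pettis_integral_UNIV:
  "has_Pettis_integral smul P M UNIV g x \<longleftrightarrow>
     (\<forall>x'\<in>continuous_dual smul P. integrable M (\<lambda>w. x' (g w)) \<and> x' x = (LINT w|M. x' (g w)))"
  by (simp add: has_Pettis_integral_def set_integrable_def set_lebesgue_integral_def)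

lemma has_Pettis_integral_add:
  assumes "has_Pettis_integral smul P M \<Omega> g x" "has_Pettis_integral smul P M \<Omega> h y"
  shows "has_Pettis_integral smul P M \<Omega> (\<lambda>w. g w + h w) (x + y)"
  unfolding has_Pettis_integral_def
proof
  fix x' assume x': "x' \<in> continuous_dual smul P"
  interpret Vector_Spaces.linear smul "(*)" x' using x' by (rule dual_linear)
  show "set_integrable M \<Omega> (\<lambda>w. x' (g w + h w)) \<and> x' (x + y) = (LINT w:\<Omega>|M. x' (g w + h w))"
    using assms x' unfolding has_Pettis_integral_def by (auto simp: add set_integral_add)
qed

lemma has_Pettis_integral_smul:
  assumes "has_Pettis_integral smul P M \<Omega> g x"
  shows "has_Pettis_integral smul P M \<Omega> (\<lambda>w. smul c (g w)) (smul c x)"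
  unfolding has_Pettis_integral_def
proof
  fix x' assume x': "x' \<in> continuous_dual smul P"
  interpret Vector_Spaces.linear smul "(*)" x' using x' by (rule dual_linear)
  show "set_integrable M \<Omega> (\<lambda>w. x' (smul c (g w))) \<and>
      x' (smul c x) = (LINT w:\<Omega>|M. x' (smul c (g w)))"
    using assms x' unfolding has_Pettis_integral_def by (auto simp: scale)
qed

lemma has_Pettis_integral_diff:
  assumes "has_Pettis_integral smul P M \<Omega> g x" "has_Pettis_integral smul P M \<Omega> h y"
  shows "has_Pettis_integral smul P M \<Omega> (\<lambda>w. g w - h w) (x - y)"
  using has_Pettis_integral_add[OF assms(1) has_Pettis_integral_smul[OF assms(2), of "-1"]] by simp

lemma has_Pettis_integral_const:
  assumes "integrable M w"
  shows "has_Pettis_integral smul P M UNIV (\<lambda>s. rmul (w s) x) (rmul (integral\<^sup>L M w) x)"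
  unfolding has_Pettis_integral_UNIV
proof
  fix x' assume x': "x' \<in> continuous_dual smul P"
  interpret Vector_Spaces.linear smul "(*)" x' using x' by (rule dual_linear)
  show "integrable M (\<lambda>s. x' (rmul (w s) x)) \<and>
      x' (rmul (integral\<^sup>L M w) x) = (LINT s|M. x' (rmul (w s) x))"
    using assms by (simp add: scale)
qed

lemma has_Pettis_integral_sum:
  assumes "\<And>i. i \<in> I \<Longrightarrow> has_Pettis_integral smul P M UNIV (g i) (x i)"
  shows "has_Pettis_integral smul P M UNIV (\<lambda>w. \<Sum>i\<in>I. g i w) (\<Sum>i\<in>I. x i)"
  unfolding has_Pettis_integral_UNIV
proof
  fix x' assume x': "x' \<in> continuous_dual smul P"
  interpret Vector_Spaces.linear smul "(*)" x' using x' by (rule dual_linear)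
  show "integrable M (\<lambda>w. x' (\<Sum>i\<in>I. g i w)) \<and>
      x' (\<Sum>i\<in>I. x i) = (LINT w|M. x' (\<Sum>i\<in>I. g i w))"
    using assms x' unfolding has_Pettis_integral_UNIV by (simp add: sum)
qed

text \<open>Only finitely many fixed vectors occur, with scalar weights between 0 and 1, so the
  integral is explicit.\<close>

lemma has_Pettis_integral_Bernstein_exp:
  assumes "halfline_measure M"
  shows "has_Pettis_integral smul P M UNIV (Bernstein_exp n h)
    (\<Sum>k\<le>n. rmul (LINT s|M. Bernstein n k (exp (- s))) (h (- ln (real k / real n))))"
proof -
  interpret halfline_measure M by fact
  have "integrable M (\<lambda>s. Bernstein n k (exp (- s)))" if "k \<le> n" for k
  proof (rule integrable_bounded[where C = 1])
    fix s :: real assume s: "0 \<le> s"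
    have "Bernstein n k (exp (- s)) \<le> (\<Sum>k\<le>n. Bernstein n k (exp (- s)))"
      using that by (intro member_le_sum Bernstein_exp_weight_nonneg s) auto
    then show "norm (Bernstein n k (exp (- s))) \<le> 1"
      using Bernstein_exp_weight_nonneg[OF s, of n k] by simp
  qed (simp add: Bernstein_def)
  then show ?thesis unfolding Bernstein_exp_def
    by (intro has_Pettis_integral_sum has_Pettis_integral_const) auto
qed

lemma Pettis_seminorm_le_UNIV:
  assumes "p \<in> P" "has_Pettis_integral smul P M UNIV g x" "integrable M (\<lambda>w. p (g w))"
  shows "p x \<le> (LINT w|M. p (g w))"
  using Pettis_seminorm_le[OF assms(1,2)] assms(3)
  by (simp add: set_integrable_def set_lebesgue_integral_def)

lemma integrable_seminorm:
  assumes M: "halfline_measure M" and p: "p \<in> P"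
    and h: "continuous_map euclidean \<tau> h" "\<And>s. 0 \<le> s \<Longrightarrow> p (h s) \<le> C"
  shows "integrable M (\<lambda>s. p (h s))"
proof -
  interpret halfline_measure M by fact
  show ?thesis
    by (rule integrable_bounded[where C = C])
      (use h p in \<open>auto intro!: borel_measurable_continuous_onI continuous_on_seminorm
        simp: seminorm_nonneg\<close>)
qed

text \<open>Dominated convergence for the error function. \<open>C\<close> depends on
  \<open>p\<close> and \<open>h\<close> only, and the statement covers all half-line measures, which
  serves both the existence of integrals and their limits along a family of measures.\<close>

lemma Bernstein_exp_error:
  assumes p: "p \<in> P"
    and h: "continuous_map euclidean \<tau> h" "seminorm_bounded P (h ` {0..})"
  obtains C where "\<And>n s. 0 \<le> s \<Longrightarrow> p (h s - Bernstein_exp n h s) \<le> C"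
    and "\<And>n. continuous_on UNIV (\<lambda>s. p (h s - Bernstein_exp n h s))"
    and "\<And>M. halfline_measure M \<Longrightarrow> (\<lambda>n. LINT s|M. p (h s - Bernstein_exp n h s)) \<longlonglongrightarrow> 0"
proof -
  obtain C where C: "\<And>s. 0 \<le> s \<Longrightarrow> p (h s) \<le> C"
    using seminorm_bounded_halfline[OF h(2) p] by blast
  have le: "p (h s - Bernstein_exp n h s) \<le> C + C" if "0 \<le> s" for n s
    using seminorm_diff[OF p, of "h s" "Bernstein_exp n h s"] C[OF that]
      seminorm_Bernstein_exp_le[where h = h and C = C, OF p that C, of n] by simp
  moreover have cont: "continuous_on UNIV (\<lambda>s. p (h s - Bernstein_exp n h s))" for n
    using h(1) continuous_map_Bernstein_exp[of n h]
    by (intro continuous_on_seminorm[OF p]) (auto simp: continuous_map_iff intro: limitin_diff)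
  moreover have "(\<lambda>n. LINT s|M. p (h s - Bernstein_exp n h s)) \<longlonglongrightarrow> 0"
    if "halfline_measure M" for M
  proof -
    interpret halfline_measure M by fact
    have "(\<lambda>n. LINT s|M. p (h s - Bernstein_exp n h s)) \<longlonglongrightarrow> (LINT s|M. 0)"
    proof (rule integral_dominated_convergence[where w = "\<lambda>_. C + C"])
      show "AE s in M. (\<lambda>n. p (h s - Bernstein_exp n h s)) \<longlonglongrightarrow> 0"
        using AE_nonneg
      proof eventually_elim
        case (elim s)
        then show ?case
          using limitin_Bernstein_exp[OF h elim] p
          by (auto simp: limitin_iff seminorm_diff_commute[OF p, of "h s"])
      qed
      show "AE s in M. norm (p (h s - Bernstein_exp n h s)) \<le> C + C" for n
        using AE_nonneg by eventually_elim (use le in \<open>simp add: seminorm_nonneg p\<close>)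
      show "(\<lambda>s. p (h s - Bernstein_exp n h s)) \<in> borel_measurable M" for n
        using borel_measurable_continuous_onI[OF cont[of n]] by simp
    qed auto
    then show ?thesis by simp
  qed
  ultimately show thesis by (rule that)
qed

end

locale seq_complete_space = Hausdorff_seminormed_space +
  assumes complete: "seminorm_Cauchy P xs \<Longrightarrow> \<exists>l. limitin \<tau> xs l sequentially"
begin

text \<open>The integrals \<open>xs n\<close> of the Bernstein polynomials are Cauchy, since
  \<open>p (xs m - xs n)\<close> is at most the sum of two integrated errors. Their limit is
  recognised as the integral by dominated convergence under each functional.\<close>

lemma Pettis_integral_exists:
  assumes M: "halfline_measure M"
    and h: "continuous_map euclidean \<tau> h" "seminorm_bounded P (h ` {0..})"
  obtains z where "has_Pettis_integral smul P M UNIV h z"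
proof -
  interpret halfline_measure M by fact
  define xs where "xs n = (\<Sum>k\<le>n. rmul (LINT s|M. Bernstein n k (exp (- s))) (h (- ln (real k / real n))))" for n
  have xs: "has_Pettis_integral smul P M UNIV (Bernstein_exp n h) (xs n)" for n
    unfolding xs_def by (rule has_Pettis_integral_Bernstein_exp[OF M])
  have "seminorm_Cauchy P xs"
    unfolding seminorm_Cauchy_def
  proof (intro ballI allI impI)
    fix p e assume p: "p \<in> P" and "0 < (e::real)"
    define r where "r n s = p (h s - Bernstein_exp n h s)" for n s
    obtain C where C: "\<And>n s. 0 \<le> s \<Longrightarrow> r n s \<le> C" "\<And>n. continuous_on UNIV (r n)"
      "\<And>M. halfline_measure M \<Longrightarrow> (\<lambda>n. LINT s|M. r n s) \<longlonglongrightarrow> 0"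
      using Bernstein_exp_error[OF p h] unfolding r_def by blast
    have ir: "integrable M (r n)" for n
      by (rule integrable_bounded[where C = C])
        (use C in \<open>auto intro: borel_measurable_continuous_onI simp: r_def seminorm_nonneg p\<close>)
    obtain N where N: "\<And>n. n \<ge> N \<Longrightarrow> (LINT s|M. r n s) < e / 2"
      using order_tendstoD(2)[OF C(3)[OF M], of "e / 2"] \<open>0 < e\<close>
      by (auto simp: eventually_sequentially)
    have "p (xs m - xs n) < e" if "m \<ge> N" "n \<ge> N" for m n
    proof -
      have le: "p (Bernstein_exp m h s - Bernstein_exp n h s) \<le> r m s + r n s" for s
        using seminorm_diff_triangle[OF p, of "Bernstein_exp m h s" "Bernstein_exp n h s" "h s"]
        by (simp add: r_def seminorm_diff_commute[OF p, of _ "h s"])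
      have i: "integrable M (\<lambda>s. p (Bernstein_exp m h s - Bernstein_exp n h s))"
      proof (rule integrable_seminorm[OF M p])
        show "continuous_map euclidean \<tau> (\<lambda>s. Bernstein_exp m h s - Bernstein_exp n h s)"
          using continuous_map_Bernstein_exp by (auto simp: continuous_map_iff intro: limitin_diff)
        show "p (Bernstein_exp m h s - Bernstein_exp n h s) \<le> C + C" if "0 \<le> s" for s
          using le[of s] C(1)[OF that] by (meson add_mono order_trans)
      qed
      have "p (xs m - xs n) \<le> (LINT s|M. p (Bernstein_exp m h s - Bernstein_exp n h s))"
        by (rule Pettis_seminorm_le_UNIV[OF p has_Pettis_integral_diff[OF xs xs] i])
      also have "\<dots> \<le> (LINT s|M. r m s + r n s)"
        using le by (intro integral_mono i Bochner_Integration.integrable_add ir)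
      also have "\<dots> = (LINT s|M. r m s) + (LINT s|M. r n s)"
        by (intro Bochner_Integration.integral_add ir)
      finally show ?thesis using N[OF that(1)] N[OF that(2)] by simp
    qed
    then show "\<exists>N. \<forall>m\<ge>N. \<forall>n\<ge>N. p (xs m - xs n) < e" by blast
  qed
  then obtain z where z: "limitin \<tau> xs z sequentially" using complete by blast
  have "has_Pettis_integral smul P M UNIV h z"
    unfolding has_Pettis_integral_UNIV
  proof
    fix x' assume x': "x' \<in> continuous_dual smul P"
    \<comment> \<open>All approximants share the seminorm bounds of \<open>h\<close>, so
      \<open>x'\<close> is bounded on their joint range by one constant, the majorant below.\<close>
    define B where "B = (\<Union>n. Bernstein_exp n h ` {0..})"
    have "seminorm_bounded P B"
      unfolding seminorm_bounded_def
    proof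
      fix p assume p: "p \<in> P"
      obtain C where C: "\<And>s. 0 \<le> s \<Longrightarrow> p (h s) \<le> C"
        using seminorm_bounded_halfline[OF h(2) p] by blast
      show "\<exists>C. \<forall>x\<in>B. p x \<le> C"
        unfolding B_def using seminorm_Bernstein_exp_le[where h = h, OF p _ C] by auto
    qed
    from dual_bounded[OF x' this] obtain C where "\<And>x. x \<in> B \<Longrightarrow> norm (x' x) \<le> C" by blast
    then have C: "norm (x' (Bernstein_exp n h s)) \<le> C" if "0 \<le> s" for n s
      using that by (auto simp: B_def)
    obtain C' where C': "\<And>x. x \<in> h ` {0..} \<Longrightarrow> norm (x' x) \<le> C'"
      using dual_bounded[OF x' h(2)] by blast
    have int: "integrable M (\<lambda>s. x' (h s))"
      by (rule integrable_bounded[where C = C'])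
        (use C' in \<open>auto intro!: borel_measurable_continuous_onI continuous_on_dual x' h\<close>)
    have "(\<lambda>n. LINT s|M. x' (Bernstein_exp n h s)) \<longlonglongrightarrow> (LINT s|M. x' (h s))"
    proof (rule integral_dominated_convergence[where w = "\<lambda>_. C"])
      show "AE s in M. (\<lambda>n. x' (Bernstein_exp n h s)) \<longlonglongrightarrow> x' (h s)"
        using AE_nonneg by eventually_elim (intro dual_limit[OF x'] limitin_Bernstein_exp h)
      show "AE s in M. norm (x' (Bernstein_exp n h s)) \<le> C" for n
        using AE_nonneg by eventually_elim (rule C)
      show "(\<lambda>s. x' (Bernstein_exp n h s)) \<in> borel_measurable M" for n
        using borel_measurable_continuous_onI[OF continuous_on_dual[OF x' continuous_map_Bernstein_exp]]
        by simp
      show "(\<lambda>s. x' (h s)) \<in> borel_measurable M"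
        using int by (rule borel_measurable_integrable)
    qed simp
    moreover have "x' (xs n) = (LINT s|M. x' (Bernstein_exp n h s))" for n
      using xs[of n] x' unfolding has_Pettis_integral_UNIV by blast
    ultimately have "(\<lambda>n. x' (xs n)) \<longlonglongrightarrow> (LINT s|M. x' (h s))" by simp
    then show "integrable M (\<lambda>s. x' (h s)) \<and> x' z = (LINT s|M. x' (h s))"
      using int dual_limit[OF x' z] LIMSEQ_unique by blast
  qed
  then show thesis by (rule that)
qed

end

section \<open>Weak convergence from convergence of Laplace transforms\<close>

text \<open>Replaces an upper limit: for each \<open>e\<close> an approximation is fixed first, and
  only the limit of the resulting bound has to be below \<open>e\<close>.\<close>

lemma tendsto_zero_bounded_limits:
  fixes X :: "'i \<Rightarrow> real"
  assumes "\<And>e. e > 0 \<Longrightarrow> \<exists>k c. (k \<longlongrightarrow> c) F \<and> c < e \<and> (\<forall>i. \<bar>X i\<bar> \<le> k i)"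
  shows "(X \<longlongrightarrow> 0) F"
proof (rule tendstoI)
  fix e :: real assume "e > 0"
  then obtain k c where k: "(k \<longlongrightarrow> c) F" "c < e" "\<And>i. \<bar>X i\<bar> \<le> k i" using assms by blast
  from order_tendstoD(2)[OF k(1,2)] show "\<forall>\<^sub>F i in F. dist (X i) 0 < e"
    by eventually_elim (use k(3) in \<open>auto intro: le_less_trans\<close>)
qed

text \<open>The limit \<open>b \<delta>\<^sub>0 + M\<close> is kept as a pair, with the atom \<open>b\<close> at 0 apart.\<close>

locale Laplace_convergence =
  fixes F :: "'i filter" and N :: "'i \<Rightarrow> real measure" and M :: "real measure" and b :: real
  assumes N: "\<And>i. halfline_measure (N i)" and M: "halfline_measure M" and b: "0 \<le> b"
    and Laplace: "\<And>l. 0 \<le> l \<Longrightarrow>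
      ((\<lambda>i. LINT s|N i. exp (- (l * s))) \<longlongrightarrow> b + (LINT s|M. exp (- (l * s)))) F"
begin

sublocale M: halfline_measure M by (rule M)

text \<open>The limit is the integral against \<open>b \<delta>\<^sub>0 + M\<close>. Integrability
  for every \<open>K\<close> covers \<open>M\<close> and all \<open>N i\<close> at once.\<close>

definition converges :: "(real \<Rightarrow> real) \<Rightarrow> bool" where
  "converges q \<longleftrightarrow> (\<forall>K. halfline_measure K \<longrightarrow> integrable K q) \<and>
     ((\<lambda>i. integral\<^sup>L (N i) q) \<longlongrightarrow> b * q 0 + integral\<^sup>L M q) F"

lemma converges_exp: "0 \<le> l \<Longrightarrow> converges (\<lambda>s. exp (- (l * s)))"
  unfolding converges_def using Laplace halfline_measure.integrable_exp by simp

text \<open>This is the Laplace transform at \<open>l = 0\<close>: total masses converge, which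
  excludes escape of mass to infinity.\<close>

lemma converges_const: "converges (\<lambda>_. c)"
proof -
  have "((\<lambda>i. c * (LINT s|N i. exp (- (0 * s)))) \<longlongrightarrow> c * (b + (LINT s|M. exp (- (0 * s))))) F"
    by (intro tendsto_mult_left Laplace) simp
  then show ?thesis unfolding converges_def
    by (auto simp: algebra_simps halfline_measure_def finite_measure.integrable_const)
qed

lemma converges_cmult:
  assumes "converges q"
  shows "converges (\<lambda>s. c * q s)"
proof -
  have "((\<lambda>i. c * integral\<^sup>L (N i) q) \<longlongrightarrow> c * (b * q 0 + integral\<^sup>L M q)) F"
    using assms unfolding converges_def by (intro tendsto_mult_left) blast
  then show ?thesis using assms unfolding converges_def by (simp add: algebra_simps)
qed

lemma converges_diff:
  assumes "converges q" "converges r"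
  shows "converges (\<lambda>s. q s - r s)"
proof -
  have "((\<lambda>i. integral\<^sup>L (N i) q - integral\<^sup>L (N i) r) \<longlongrightarrow>
      (b * q 0 + integral\<^sup>L M q) - (b * r 0 + integral\<^sup>L M r)) F"
    using assms unfolding converges_def by (intro tendsto_diff) blast+
  then show ?thesis using assms M N unfolding converges_def by (simp add: algebra_simps)
qed

lemma converges_sum:
  assumes "\<And>j. j \<in> J \<Longrightarrow> converges (q j)"
  shows "converges (\<lambda>s. \<Sum>j\<in>J. q j s)"
proof -
  have "((\<lambda>i. \<Sum>j\<in>J. integral\<^sup>L (N i) (q j)) \<longlongrightarrow> (\<Sum>j\<in>J. b * q j 0 + integral\<^sup>L M (q j))) F"
    using assms unfolding converges_def by (intro tendsto_sum) blast
  then show ?thesis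
    using assms M N unfolding converges_def by (simp add: sum.distrib sum_distrib_left)
qed

text \<open>The error \<open>r\<close> has to be small in the limiting integral, not uniformly.
  Since \<open>r\<close> converges as well, its integrals against \<open>N i\<close> approach that
  small value.\<close>

lemma converges_approx:
  assumes q: "\<And>K. halfline_measure K \<Longrightarrow> integrable K q"
    and approx: "\<And>e. e > 0 \<Longrightarrow> \<exists>g r. converges g \<and> converges r \<and>
      (\<forall>s\<ge>0. \<bar>q s - g s\<bar> \<le> r s) \<and> b * r 0 + integral\<^sup>L M r < e"
  shows "converges q"
proof -
  have "((\<lambda>i. integral\<^sup>L (N i) q - (b * q 0 + integral\<^sup>L M q)) \<longlongrightarrow> 0) F"
  proof (rule tendsto_zero_bounded_limits)
    fix e :: real assume "e > 0"
    then obtain g r where g: "converges g" and r: "converges r"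
      and le: "\<And>s. s \<ge> 0 \<Longrightarrow> \<bar>q s - g s\<bar> \<le> r s" and small: "b * r 0 + integral\<^sup>L M r < e / 2"
      using approx[of "e / 2"] by auto
    have int: "integrable K g" "integrable K r" if "halfline_measure K" for K
      using g r that unfolding converges_def by blast+
    have diff: "\<bar>integral\<^sup>L K q - integral\<^sup>L K g\<bar> \<le> integral\<^sup>L K r" if K: "halfline_measure K" for K
    proof -
      interpret halfline_measure K by fact
      show ?thesis
        using integral_abs_le[of "\<lambda>s. q s - g s" r] int[OF K] q[OF K] le by simp
    qed
    \<comment> \<open>The error enters twice, once under \<open>N i\<close> and once in the limit,
      hence the approximation to within \<open>e / 2\<close>.\<close>
    define k where "k i = integral\<^sup>L (N i) r
      + \<bar>integral\<^sup>L (N i) g - (b * g 0 + integral\<^sup>L M g)\<bar> + (b * r 0 + integral\<^sup>L M r)" for i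
    have "(k \<longlongrightarrow> (b * r 0 + integral\<^sup>L M r) + 0 + (b * r 0 + integral\<^sup>L M r)) F"
      unfolding k_def using g r unfolding converges_def
      by (intro tendsto_add tendsto_const tendsto_rabs_zero LIM_zero) auto
    moreover have "\<bar>integral\<^sup>L (N i) q - (b * q 0 + integral\<^sup>L M q)\<bar> \<le> k i" for i
    proof -
      have "\<bar>b * q 0 - b * g 0\<bar> \<le> b * r 0"
        using le[of 0] b by (simp add: abs_mult mult_left_mono flip: right_diff_distrib)
      then show ?thesis using diff[OF N[of i]] diff[OF M] unfolding k_def by linarith
    qed
    ultimately show "\<exists>k c. (k \<longlongrightarrow> c) F \<and> c < e \<and>
        (\<forall>i. \<bar>integral\<^sup>L (N i) q - (b * q 0 + integral\<^sup>L M q)\<bar> \<le> k i)"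
      using small by (intro exI[of _ k] exI[of _ "2 * (b * r 0 + integral\<^sup>L M r)"]) auto
  qed
  then show ?thesis unfolding converges_def using q by (simp add: LIM_zero_iff)
qed

lemma integrable_continuous_bounded:
  fixes q :: "real \<Rightarrow> real"
  assumes "continuous_on UNIV q" "\<And>s. 0 \<le> s \<Longrightarrow> \<bar>q s\<bar> \<le> C" "halfline_measure K"
  shows "integrable K q"
  by (rule halfline_measure.integrable_bounded[OF assms(3), where C = C])
    (use assms(1,2) in \<open>auto intro: borel_measurable_continuous_onI\<close>)

text \<open>In the variable \<open>z = exp (- s)\<close> the damped function extends continuously to \<open>[0, 1]\<close>, where
  polynomials are uniformly dense.\<close>

lemma converges_damped:
  assumes q: "continuous_on UNIV q" "\<And>s. 0 \<le> s \<Longrightarrow> \<bar>q s\<bar> \<le> C" and d: "d > 0"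
  shows "converges (\<lambda>s. exp (- (d * s)) * q s)"
proof (rule converges_approx)
  fix K :: "real measure" assume "halfline_measure K"
  then show "integrable K (\<lambda>s. exp (- (d * s)) * q s)"
  proof (rule integrable_continuous_bounded[rotated 2])
    show "\<bar>exp (- (d * s)) * q s\<bar> \<le> 1 * C" if "0 \<le> s" for s
      unfolding abs_mult using q(2)[OF that] that d by (intro mult_mono) auto
  qed (intro continuous_intros q)
next
  fix e :: real assume e: "e > 0"
  \<comment> \<open>\<open>0 powr d = 0\<close>, so \<open>G 0 = 0\<close>, and the bound
    \<open>z powr d * C\<close> gives continuity there.\<close>
  define G where "G z = z powr d * q (- ln z)" for z
  have G: "continuous_on {0..1} G"
    unfolding continuous_on_eq_continuous_within
  proof
    fix z :: real assume z: "z \<in> {0..1}"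
    show "continuous (at z within {0..1}) G"
    proof (cases "z = 0")
      case False
      then have "isCont G z"
        unfolding G_def using z d q(1)
        by (auto intro!: continuous_intros isCont_o2[of z "\<lambda>z. - ln z" q] simp: continuous_on_eq_continuous_at)
      then show ?thesis by (rule continuous_at_imp_continuous_at_within)
    next
      case True
      have "((\<lambda>z. z powr d * C) \<longlongrightarrow> 0 powr d * C) (at 0 within {0..1})"
        using d by (intro tendsto_intros) (auto simp: eventually_at_filter)
      then have "((\<lambda>z. z powr d * C) \<longlongrightarrow> 0) (at 0 within {0..1})" by simp
      then have "(G \<longlongrightarrow> 0) (at 0 within {0..1})"
      proof (rule Lim_null_comparison[rotated])
        show "\<forall>\<^sub>F z in at 0 within {0..1}. norm (G z) \<le> z powr d * C"
          using q(2) by (auto simp: eventually_at_filter G_def abs_mult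
              intro!: always_eventually mult_left_mono)
      qed
      then show ?thesis using True by (simp add: continuous_within G_def)
    qed
  qed
  \<comment> \<open>\<open>m\<close> is the total mass of the limit; dividing by
    \<open>m + 1\<close> also covers \<open>m = 0\<close>.\<close>
  define m where "m = b + measure M UNIV"
  have m: "0 \<le> m" using b by (simp add: m_def)
  define e' where "e' = e / (m + 1)"
  have e': "e' > 0" using e m by (simp add: e'_def)
  obtain pol where pol: "real_polynomial_function pol" "\<And>z. z \<in> {0..1} \<Longrightarrow> \<bar>G z - pol z\<bar> < e'"
    using Stone_Weierstrass_real_polynomial_function[OF compact_Icc G e'] by blast
  obtain a n where a: "pol = (\<lambda>z. \<Sum>i\<le>n. a i * z ^ i)"
    using pol(1) unfolding real_polynomial_function_iff_sum by blast
  \<comment> \<open>A polynomial in \<open>exp (- s)\<close> is a linear combination of Laplace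
    kernels at integers \<open>l \<ge> 0\<close>.\<close>
  have "converges (\<lambda>s. pol (exp (- s)))"
  proof -
    have "exp (- s) ^ i = exp (- (real i * s))" for s :: real and i
      by (metis exp_of_nat_mult minus_mult_right)
    then show ?thesis
      unfolding a by (simp only:) (intro converges_sum converges_cmult converges_exp, simp)
  qed
  moreover have "converges (\<lambda>_. e')" by (rule converges_const)
  moreover have "\<bar>exp (- (d * s)) * q s - pol (exp (- s))\<bar> \<le> e'" if "s \<ge> 0" for s
    using pol(2)[of "exp (- s)"] that by (simp add: G_def powr_def)
  moreover have "b * e' + (LINT s|M. e') < e"
  proof -
    have "b * e' + (LINT s|M. e') = m * e'"
      using sets_eq_imp_space_eq[OF M.sets_M] by (simp add: m_def algebra_simps)
    also have "\<dots> < e" using e m by (simp add: e'_def field_simps)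
    finally show ?thesis .
  qed
  ultimately show "\<exists>g r. converges g \<and> converges r \<and>
      (\<forall>s\<ge>0. \<bar>exp (- (d * s)) * q s - g s\<bar> \<le> r s) \<and> b * r 0 + integral\<^sup>L M r < e"
    by (intro exI[of _ "\<lambda>s. pol (exp (- s))"] exI[of _ "\<lambda>_. e'"]) auto
qed

text \<open>Damping by \<open>exp (- s / (n + 1))\<close> costs at most \<open>r n\<close>, a
  combination of a constant and a Laplace kernel. It vanishes at 0, so the atom sees no error, and
  its integral against \<open>M\<close> tends to 0.\<close>

lemma converges_continuous_bounded:
  assumes q: "continuous_on UNIV q" "\<And>s. 0 \<le> s \<Longrightarrow> \<bar>q s\<bar> \<le> C"
  shows "converges q"
proof (rule converges_approx)
  show "integrable K q" if "halfline_measure K" for K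
    using q that by (rule integrable_continuous_bounded)
  fix e :: real assume e: "e > 0"
  define r where "r n s = C * (1 - exp (- (inverse (real (Suc n)) * s)))" for n s
  have C0: "0 \<le> C" using q(2)[of 0] by simp
  have "(\<lambda>n. integral\<^sup>L M (r n)) \<longlonglongrightarrow> (LINT s|M. C * (1 - exp (- (0 * s))))"
  proof (rule integral_dominated_convergence[where w = "\<lambda>_. C"])
    show "AE s in M. (\<lambda>n. r n s) \<longlonglongrightarrow> C * (1 - exp (- (0 * s)))"
      unfolding r_def by (intro AE_I2 tendsto_intros LIMSEQ_inverse_real_of_nat)
    show "AE s in M. norm (r n s) \<le> C" for n
      using M.AE_nonneg
    proof eventually_elim
      case (elim s)
      then show ?case using C0 by (auto simp: r_def abs_mult intro: mult_left_le)
    qed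
    show "r n \<in> borel_measurable M" for n by (simp add: r_def[abs_def])
  qed auto
  then have "\<forall>\<^sub>F n in sequentially. integral\<^sup>L M (r n) < e"
    using e by (auto dest: order_tendstoD(2))
  then obtain n where n: "integral\<^sup>L M (r n) < e" by (auto simp: eventually_sequentially)
  let ?d = "inverse (real (Suc n))"
  have "converges (\<lambda>s. exp (- (?d * s)) * q s)"
    by (rule converges_damped[OF q]) auto
  moreover have "converges (r n)"
    unfolding r_def by (intro converges_cmult converges_diff converges_const converges_exp) auto
  moreover have "\<bar>q s - exp (- (?d * s)) * q s\<bar> \<le> r n s" if "s \<ge> 0" for s
  proof -
    have "q s - exp (- (?d * s)) * q s = q s * (1 - exp (- (?d * s)))"
      by (simp add: algebra_simps)
    then have "\<bar>q s - exp (- (?d * s)) * q s\<bar> = \<bar>q s\<bar> * (1 - exp (- (?d * s)))"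
      using that by (simp add: abs_mult)
    also have "\<dots> \<le> r n s"
      unfolding r_def using q(2)[OF that] that by (intro mult_right_mono) auto
    finally show ?thesis .
  qed
  moreover have "b * r n 0 + integral\<^sup>L M (r n) < e" using n by (simp add: r_def)
  ultimately show "\<exists>g r. converges g \<and> converges r \<and>
      (\<forall>s\<ge>0. \<bar>q s - g s\<bar> \<le> r s) \<and> b * r 0 + integral\<^sup>L M r < e"
    by (intro exI[of _ "\<lambda>s. exp (- (?d * s)) * q s"] exI[of _ "r n"]) auto
qed

end

section \<open>Weak convergence for vector-valued integrands\<close>

context seminormed_space
begin

text \<open>Replace \<open>h\<close> by a Bernstein polynomial \<open>g\<close>: its integrals are
  finite sums whose scalar weights converge. The replacement costs at most the integral of
  \<open>r n\<close>, a real bounded continuous function to which scalar weak convergence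
  applies.\<close>

lemma limitin_Pettis_integral:
  assumes L: "Laplace_convergence F N M b"
    and h: "continuous_map euclidean \<tau> h" "seminorm_bounded P (h ` {0..})"
    and zN: "\<And>i. has_Pettis_integral smul P (N i) UNIV h (zN i)"
    and zM: "has_Pettis_integral smul P M UNIV h z"
  shows "limitin \<tau> zN (rmul b (h 0) + z) F"
  unfolding limitin_iff
proof
  interpret Laplace_convergence F N M b by fact
  fix p assume p: "p \<in> P"
  define r where "r n s = p (h s - Bernstein_exp n h s)" for n s
  obtain C where C: "\<And>n s. 0 \<le> s \<Longrightarrow> r n s \<le> C" "\<And>n. continuous_on UNIV (r n)"
    "\<And>M. halfline_measure M \<Longrightarrow> (\<lambda>n. LINT s|M. r n s) \<longlonglongrightarrow> 0"
    using Bernstein_exp_error[OF p h] unfolding r_def by blast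
  have r: "converges (r n)" for n
    by (rule converges_continuous_bounded[OF C(2), of _ C])
      (use C(1) in \<open>auto simp: r_def seminorm_nonneg p\<close>)
  show "((\<lambda>i. p (zN i - (rmul b (h 0) + z))) \<longlongrightarrow> 0) F"
  proof (rule tendsto_zero_bounded_limits)
    fix e :: real assume e: "e > 0"
    have "(\<lambda>n. r n 0) \<longlonglongrightarrow> 0"
      using limitin_Bernstein_exp[OF h, of 0] p
      by (auto simp: limitin_iff r_def seminorm_diff_commute[OF p, of "h 0"])
    then have "(\<lambda>n. b * r n 0 + (LINT s|M. r n s)) \<longlonglongrightarrow> b * 0 + 0"
      by (intro tendsto_intros C(3) M)
    from order_tendstoD(2)[OF this, of "e / 2"]
    have "\<forall>\<^sub>F n in sequentially. b * r n 0 + (LINT s|M. r n s) < e / 2" using e by simp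
    then obtain n where n: "b * r n 0 + (LINT s|M. r n s) < e / 2"
      by (auto simp: eventually_sequentially)
    define g where "g = Bernstein_exp n h"
    define w where "w k s = Bernstein n k (exp (- s))" for k s
    define x where "x k = h (- ln (real k / real n))" for k
    define yN where "yN i = (\<Sum>k\<le>n. rmul (integral\<^sup>L (N i) (w k)) (x k))" for i
    define y where "y = (\<Sum>k\<le>n. rmul (integral\<^sup>L M (w k)) (x k))"
    have yN: "has_Pettis_integral smul P (N i) UNIV g (yN i)" for i
      unfolding g_def yN_def w_def x_def by (rule has_Pettis_integral_Bernstein_exp[OF N])
    have y: "has_Pettis_integral smul P M UNIV g y"
      unfolding g_def y_def w_def x_def by (rule has_Pettis_integral_Bernstein_exp[OF M])
    have err: "p (u - v) \<le> (LINT s|K. r n s)"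
      if "halfline_measure K" "has_Pettis_integral smul P K UNIV h u"
        "has_Pettis_integral smul P K UNIV g v" for K u v
      unfolding r_def
    proof (rule Pettis_seminorm_le_UNIV[OF p])
      show "has_Pettis_integral smul P K UNIV (\<lambda>s. h s - Bernstein_exp n h s) (u - v)"
        using has_Pettis_integral_diff[OF that(2,3)] unfolding g_def .
      show "integrable K (\<lambda>s. p (h s - Bernstein_exp n h s))"
        using r[of n] that(1) unfolding converges_def r_def by blast
    qed
    have w: "converges (w k)" if "k \<le> n" for k
    proof (rule converges_continuous_bounded[where C = 1])
      show "continuous_on UNIV (w k)" unfolding w_def Bernstein_def by (intro continuous_intros)
      show "\<bar>w k s\<bar> \<le> 1" if "0 \<le> s" for s
      proof -
        have "w k s \<le> (\<Sum>k\<le>n. w k s)"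
          unfolding w_def using \<open>k \<le> n\<close>
          by (intro member_le_sum Bernstein_exp_weight_nonneg that) auto
        then show ?thesis
          using Bernstein_exp_weight_nonneg[OF that, of n k] by (simp add: w_def)
      qed
    qed
    have "limitin \<tau> yN (\<Sum>k\<le>n. rmul (b * w k 0 + integral\<^sup>L M (w k)) (x k)) F"
      unfolding yN_def using w unfolding converges_def
      by (intro limitin_sum limitin_smul limitin_const' tendsto_of_real) auto
    also have "(\<Sum>k\<le>n. rmul (b * w k 0 + integral\<^sup>L M (w k)) (x k)) = rmul b (g 0) + y"
      by (simp add: y_def g_def Bernstein_exp_def w_def x_def scale_left_distrib sum.distrib
          scale_sum_right)
    finally have lim: "((\<lambda>i. p (yN i - (rmul b (g 0) + y))) \<longlongrightarrow> 0) F"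
      using p unfolding limitin_iff by blast
    define k where "k i = (LINT s|N i. r n s) + p (yN i - (rmul b (g 0) + y))
        + (b * r n 0 + (LINT s|M. r n s))" for i
    have "(k \<longlongrightarrow> (b * r n 0 + (LINT s|M. r n s)) + 0 + (b * r n 0 + (LINT s|M. r n s))) F"
      unfolding k_def using r[of n] unfolding converges_def
      by (intro tendsto_add tendsto_const lim) auto
    moreover have "\<bar>p (zN i - (rmul b (h 0) + z))\<bar> \<le> k i" for i
    proof -
      \<comment> \<open>Passing from \<open>h\<close> to \<open>g\<close> and back gives one error
        under \<open>N i\<close>, one under \<open>M\<close>, and \<open>b * r n 0\<close> from the
        atom.\<close>
      have "zN i - (rmul b (h 0) + z) = (zN i - yN i) + (yN i - (rmul b (g 0) + y))
          - (rmul b (h 0 - g 0) + (z - y))"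
        by (simp add: scale_right_diff_distrib algebra_simps)
      also have "p \<dots> \<le> p (zN i - yN i) + p (yN i - (rmul b (g 0) + y))
          + (p (rmul b (h 0 - g 0)) + p (z - y))"
        by (intro order_trans[OF seminorm_diff[OF p]] add_mono seminorm_triangle p)
      also have "\<dots> \<le> k i"
        unfolding k_def using err[OF N zN yN, of i] err[OF M zM y] b
        by (simp add: seminorm_rmul p r_def[abs_def] g_def)
      finally show ?thesis by (simp add: seminorm_nonneg p)
    qed
    ultimately show "\<exists>k c. (k \<longlongrightarrow> c) F \<and> c < e \<and>
        (\<forall>i. \<bar>p (zN i - (rmul b (h 0) + z))\<bar> \<le> k i)"
      using n by (intro exI[of _ k] exI[of _ "2 * (b * r n 0 + (LINT s|M. r n s))"]) auto
  qed
qed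

end

section \<open>Weighted measures\<close>

definition weighted_measure :: "real measure \<Rightarrow> real set \<Rightarrow> (real \<Rightarrow> real) \<Rightarrow> real measure" where
  "weighted_measure M \<Omega> w = density M (\<lambda>s. ennreal (indicator \<Omega> s * w s))"

context
  fixes M :: "real measure" and \<Omega> :: "real set" and w :: "real \<Rightarrow> real"
  assumes sets [measurable_cong]: "sets M = sets borel"
    and \<Omega> [measurable]: "\<Omega> \<in> sets borel"
    and w [measurable]: "w \<in> borel_measurable borel" and w0: "\<And>s. s \<in> \<Omega> \<Longrightarrow> 0 \<le> w s"
begin

lemma integrable_weighted_measure:
  fixes g :: "real \<Rightarrow> 'b::{banach,second_countable_topology}"
  assumes [measurable]: "g \<in> borel_measurable borel"
  shows "integrable (weighted_measure M \<Omega> w) g \<longleftrightarrow> set_integrable M \<Omega> (\<lambda>s. w s *\<^sub>R g s)"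
    and "integral\<^sup>L (weighted_measure M \<Omega> w) g = (LINT s:\<Omega>|M. w s *\<^sub>R g s)"
  unfolding weighted_measure_def set_integrable_def set_lebesgue_integral_def
  by (subst integrable_density integral_density; use w0 in \<open>auto simp: indicator_def\<close>)+

text \<open>Integrability of the weight is exactly finiteness of the new measure; \<open>M\<close>
  itself may be infinite, as a Levy measure can be near 0.\<close>

lemma halfline_weighted_measure:
  assumes int: "set_integrable M \<Omega> w" and sub: "\<Omega> \<subseteq> {0..}"
  shows "halfline_measure (weighted_measure M \<Omega> w)"
proof (intro halfline_measure.intro halfline_measure_axioms.intro finite_measureI)
  have "(\<integral>\<^sup>+ s. ennreal (indicator \<Omega> s * w s) \<partial>M)
      = (\<integral>\<^sup>+ s. ennreal (norm (indicator \<Omega> s *\<^sub>R w s)) \<partial>M)"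
    using w0 by (intro nn_integral_cong) (auto simp: indicator_def)
  also have "\<dots> < \<infinity>"
    using int unfolding set_integrable_def integrable_iff_bounded by blast
  finally show "emeasure (weighted_measure M \<Omega> w) (space (weighted_measure M \<Omega> w)) \<noteq> \<infinity>"
    unfolding weighted_measure_def by (simp add: emeasure_density cong: nn_integral_cong)
  show "sets (weighted_measure M \<Omega> w) = sets borel"
    by (simp add: weighted_measure_def sets)
  show "AE s in weighted_measure M \<Omega> w. 0 \<le> s"
    unfolding weighted_measure_def
    by (subst AE_density) (use sub in \<open>auto simp: indicator_def\<close>)
qed

end

text \<open>Change of density under each functional; measurability of \<open>x' (h s)\<close> is
  read off from its integrability, since both measures are Borel.\<close>

lemma (in seminormed_space) has_Pettis_integral_weighted:
  assumes M: "sets M = sets borel" "\<Omega> \<in> sets borel" "w \<in> borel_measurable borel"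
    "\<And>s. s \<in> \<Omega> \<Longrightarrow> 0 \<le> w s"
    and h: "has_Pettis_integral smul P (weighted_measure M \<Omega> w) UNIV h z"
  shows "has_Pettis_integral smul P M \<Omega> (\<lambda>s. rmul (w s) (h s)) z"
  unfolding has_Pettis_integral_def
proof
  fix x' assume x': "x' \<in> continuous_dual smul P"
  interpret Vector_Spaces.linear smul "(*)" x' using x' by (rule dual_linear)
  have eq: "x' (rmul (w s) (h s)) = w s *\<^sub>R x' (h s)" for s
    by (simp add: scale scaleR_conv_of_real)
  have int: "integrable (weighted_measure M \<Omega> w) (\<lambda>s. x' (h s))"
    and z: "x' z = integral\<^sup>L (weighted_measure M \<Omega> w) (\<lambda>s. x' (h s))"
    using h x' unfolding has_Pettis_integral_UNIV by auto
  have "(\<lambda>s. x' (h s)) \<in> borel_measurable borel"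
    using borel_measurable_integrable[OF int] M(1)
    by (simp add: weighted_measure_def cong: measurable_cong_sets)
  from integrable_weighted_measure[OF M this] int z
  show "set_integrable M \<Omega> (\<lambda>s. x' (rmul (w s) (h s))) \<and>
      x' z = (LINT s:\<Omega>|M. x' (rmul (w s) (h s)))"
    unfolding eq by simp
qed

section \<open>The Levy triplet and the convolution semigroup\<close>

lemma exp_difference_quotient: "((\<lambda>t. (exp (- t * c) - 1) / t) \<longlongrightarrow> - c) (at_right (0::real))"
proof -
  have "((\<lambda>t. exp (- t * c)) has_real_derivative - c) (at 0)"
    by (auto intro!: derivative_eq_intros)
  then have "((\<lambda>t. (exp (- t * c) - 1) / t) \<longlongrightarrow> - c) (at 0)"
    by (simp add: has_field_derivative_iff)
  then show ?thesis by (rule filterlim_mono) (auto simp: at_le)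
qed

locale Bernstein_convolution =
  fixes f :: "real \<Rightarrow> real" and a b :: real and \<mu> :: "real measure" and \<nu> :: "real \<Rightarrow> real measure"
  assumes Levy: "Levy_triplet f a b \<mu>" and conv: "convolution_semigroup_of f \<nu>"
begin

lemma ab: "0 \<le> a" "0 \<le> b"
  and sets_\<mu> [measurable_cong, simp]: "sets \<mu> = sets borel"
  and integrable_min: "set_integrable \<mu> {0<..} (\<lambda>t. min 1 t)"
  and f_eq: "l > 0 \<Longrightarrow> f l = a + b * l + (LINT t:{0<..}|\<mu>. 1 - exp (- l * t))"
  using Levy unfolding Levy_triplet_def Radon_measure_on_def by auto

lemma sets_\<nu> [measurable_cong, simp]: "t \<ge> 0 \<Longrightarrow> sets (\<nu> t) = sets borel"
  and mass_\<nu>: "t \<ge> 0 \<Longrightarrow> emeasure (\<nu> t) {0..} \<le> 1"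
  and Laplace_\<nu>: "l > 0 \<Longrightarrow> t \<ge> 0 \<Longrightarrow> (LINT s:{0..}|\<nu> t. exp (- l * s)) = exp (- t * f l)"
  using conv unfolding convolution_semigroup_of_def Radon_measure_on_def by auto

text \<open>The left side is below both 1 and \<open>l * s\<close>. For \<open>l \<le> 1\<close> the
  constant is 1, which yields a majorant independent of \<open>l\<close> for the limit
  \<open>l \<rightarrow> 0\<close>.\<close>

lemma one_minus_exp_le:
  assumes "0 \<le> l" "0 \<le> (s::real)"
  shows "1 - exp (- l * s) \<le> max 1 l * min 1 s"
proof -
  have "1 - l * s \<le> exp (- l * s)" using exp_ge_add_one_self[of "- l * s"] by simp
  moreover have "l * s \<le> max 1 l * s" using assms by (intro mult_right_mono) auto
  moreover have "0 < exp (- l * s)" by simp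
  ultimately show ?thesis 
    using max.cobounded1[of 1 l] by (cases "s \<le> 1") (simp_all add: min_def del: exp_gt_zero max.cobounded1)
qed

lemma integrable_one_minus_exp:
  assumes "0 \<le> l"
  shows "set_integrable \<mu> {0<..} (\<lambda>t. 1 - exp (- l * t))"
proof (rule set_integrable_bound)
  show "set_integrable \<mu> {0<..} (\<lambda>t. max 1 l * min 1 t)"
    using integrable_min by simp
  show "set_borel_measurable \<mu> {0<..} (\<lambda>t. 1 - exp (- l * t))"
    unfolding set_borel_measurable_def by measurable
  show "AE t in \<mu>. t \<in> {0<..} \<longrightarrow> norm (1 - exp (- l * t)) \<le> norm (max 1 l * min 1 t)"
    using one_minus_exp_le[OF assms] assms by (intro AE_I2) (simp add: abs_mult)
qed

text \<open>The extension of \<open>f\<close> by its right limit at 0, which need not be the junk value \<open>f 0\<close>.\<close>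

definition \<phi> :: "real \<Rightarrow> real" where
  "\<phi> l = a + b * l + (LINT t:{0<..}|\<mu>. 1 - exp (- l * t))"

lemma \<phi>_eq: "l > 0 \<Longrightarrow> \<phi> l = f l" by (simp add: \<phi>_def f_eq)

lemma \<phi>_0: "\<phi> 0 = a" by (simp add: \<phi>_def)

lemma \<phi>_tendsto: "(\<lambda>n. \<phi> (inverse (real (Suc n)))) \<longlonglongrightarrow> a"
proof -
  let ?l = "\<lambda>n. inverse (real (Suc n))"
  have "(\<lambda>n. LINT t:{0<..}|\<mu>. 1 - exp (- ?l n * t)) \<longlonglongrightarrow> (LINT t|\<mu>. 0)"
    unfolding set_lebesgue_integral_def
  proof (rule integral_dominated_convergence[where w = "\<lambda>t. indicator {0<..} t *\<^sub>R min 1 t"])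
    show "integrable \<mu> (\<lambda>t. indicator {0<..} t *\<^sub>R min 1 t)"
      using integrable_min unfolding set_integrable_def .
    show "AE t in \<mu>. (\<lambda>n. indicator {0<..} t *\<^sub>R (1 - exp (- ?l n * t))) \<longlonglongrightarrow> 0"
    proof (rule AE_I2)
      fix t
      have "(\<lambda>n. indicator {0<..} t *\<^sub>R (1 - exp (- ?l n * t)))
          \<longlonglongrightarrow> indicator {0<..} t *\<^sub>R (1 - exp (- 0 * t))"
        by (intro tendsto_intros LIMSEQ_inverse_real_of_nat)
      then show "(\<lambda>n. indicator {0<..} t *\<^sub>R (1 - exp (- ?l n * t))) \<longlonglongrightarrow> 0" by simp
    qed
    show "AE t in \<mu>. norm (indicator {0<..} t *\<^sub>R (1 - exp (- ?l n * t)))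
        \<le> indicator {0<..} t *\<^sub>R min 1 t" for n
    proof (rule AE_I2)
      fix t :: real
      have "max 1 (?l n) = 1" by (simp add: inverse_le_1_iff)
      then show "norm (indicator {0<..} t *\<^sub>R (1 - exp (- ?l n * t)))
          \<le> indicator {0<..} t *\<^sub>R min 1 t"
        using one_minus_exp_le[of "?l n" t] by (auto simp: indicator_def simp del: of_nat_Suc)
    qed
  qed measurable
  moreover have "(\<lambda>n. a + b * ?l n) \<longlonglongrightarrow> a + b * 0"
    by (intro tendsto_intros LIMSEQ_inverse_real_of_nat)
  ultimately have "(\<lambda>n. a + b * ?l n + (LINT t:{0<..}|\<mu>. 1 - exp (- ?l n * t))) \<longlonglongrightarrow> a + b * 0 + (LINT t|\<mu>. 0)"
    by (rule tendsto_add[rotated])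
  then show ?thesis unfolding \<phi>_def by simp
qed

lemma integrable_\<nu>:
  fixes g :: "real \<Rightarrow> 'b::{banach,second_countable_topology}"
  assumes t: "t \<ge> 0" and g: "g \<in> borel_measurable borel" "\<And>s. 0 \<le> s \<Longrightarrow> norm (g s) \<le> C"
  shows "set_integrable (\<nu> t) {0..} g"
  unfolding set_integrable_def
proof (rule integrableI_bounded_set_indicator[where B = C])
  show "g \<in> borel_measurable (\<nu> t)"
    using g(1) t by (simp cong: measurable_cong_sets)
  show "emeasure (\<nu> t) {0..} < \<infinity>"
    using mass_\<nu>[OF t] by (simp add: le_less_trans[OF _ ennreal_one_less_top])
qed (use g(2) t in auto)

text \<open>The defining formula covers \<open>l > 0\<close>; at \<open>l = 0\<close> both sides are
  limits along \<open>1 / (n + 1)\<close>. This case says that \<open>\<nu> t\<close> has total mass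
  \<open>exp (- t * a)\<close>.\<close>

lemma Laplace_\<nu>_\<phi>:
  assumes t: "t \<ge> 0" and l: "l \<ge> 0"
  shows "(LINT s:{0..}|\<nu> t. exp (- l * s)) = exp (- t * \<phi> l)"
proof (cases "l = 0")
  case False
  then show ?thesis using Laplace_\<nu>[OF _ t] \<phi>_eq l by simp
next
  case True
  let ?l = "\<lambda>n. inverse (real (Suc n))"
  have [measurable_cong]: "sets (\<nu> t) = sets borel" using t by simp
  have "(\<lambda>n. LINT s:{0..}|\<nu> t. exp (- ?l n * s)) \<longlonglongrightarrow> (LINT s:{0..}|\<nu> t. exp (- 0 * s))"
    unfolding set_lebesgue_integral_def
  proof (rule integral_dominated_convergence[where w = "\<lambda>s. indicator {0..} s *\<^sub>R (1::real)"])
    show "integrable (\<nu> t) (\<lambda>s. indicator {0..} s *\<^sub>R (1::real))"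
      using integrable_\<nu>[OF t, of "\<lambda>_. 1::real" 1] unfolding set_integrable_def by simp
    show "AE s in \<nu> t. (\<lambda>n. indicator {0..} s *\<^sub>R exp (- ?l n * s))
        \<longlonglongrightarrow> indicator {0..} s *\<^sub>R exp (- 0 * s)"
      by (intro AE_I2 tendsto_intros LIMSEQ_inverse_real_of_nat)
    show "AE s in \<nu> t. norm (indicator {0..} s *\<^sub>R exp (- ?l n * s)) \<le> indicator {0..} s *\<^sub>R 1" for n
      by (intro AE_I2) (auto simp: indicator_def simp del: of_nat_Suc)
  qed measurable
  moreover have "(LINT s:{0..}|\<nu> t. exp (- ?l n * s)) = exp (- t * \<phi> (?l n))" for n
    using Laplace_\<nu>[OF _ t, of "?l n"] \<phi>_eq[of "?l n"] by simp
  ultimately have "(\<lambda>n. exp (- t * \<phi> (?l n))) \<longlonglongrightarrow> (LINT s:{0..}|\<nu> t. exp (- 0 * s))" by simp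
  moreover have "(\<lambda>n. exp (- t * \<phi> (?l n))) \<longlonglongrightarrow> exp (- t * a)"
    by (intro tendsto_intros \<phi>_tendsto)
  ultimately show ?thesis using True \<phi>_0 LIMSEQ_unique by fastforce
qed

text \<open>For \<open>t \<le> 0\<close>, where \<open>\<nu> t\<close> says nothing, the null measure is a harmless choice.\<close>

definition N :: "real \<Rightarrow> real measure" where
  "N t = (if t > 0 then weighted_measure (\<nu> t) {0..} (\<lambda>s. (1 - exp (- s)) / t) else null_measure borel)"

definition M :: "real measure" where
  "M = weighted_measure \<mu> {0<..} (\<lambda>s. 1 - exp (- s))"

lemma halfline_M: "halfline_measure M"
  unfolding M_def
  by (rule halfline_weighted_measure) (use integrable_one_minus_exp[of 1] in auto)

lemma integrable_weight_\<nu>: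
  assumes t: "t > 0"
  shows "set_integrable (\<nu> t) {0..} (\<lambda>s. (1 - exp (- s)) / t)"
  by (rule integrable_\<nu>[where C = "1 / t"]) (use t in \<open>auto simp: divide_right_mono\<close>)

lemma halfline_N: "halfline_measure (N t)"
proof (cases "t > 0")
  case True
  then show ?thesis unfolding N_def
    using integrable_weight_\<nu>[OF True] by (auto intro!: halfline_weighted_measure)
next
  case False
  have "halfline_measure (null_measure borel)"
    by (intro halfline_measure.intro halfline_measure_axioms.intro finite_measureI AE_I[of _ _ UNIV])
      auto
  with False show ?thesis by (simp add: N_def)
qed

text \<open>The weight turns the Laplace kernel at \<open>l\<close> into a difference of the
  integrands of \<open>\<phi>\<close> at \<open>l + 1\<close> and \<open>l\<close>; \<open>b\<close>
  is the increment of the linear term.\<close>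

lemma integral_exp_M:
  assumes l: "0 \<le> l"
  shows "b + (LINT s|M. exp (- (l * s))) = \<phi> (l + 1) - \<phi> l"
proof -
  have "(LINT s|M. exp (- (l * s))) = (LINT s:{0<..}|\<mu>. (1 - exp (- s)) *\<^sub>R exp (- (l * s)))"
    unfolding M_def by (rule integrable_weighted_measure) auto
  also have "\<dots> = (LINT s:{0<..}|\<mu>. (1 - exp (- (l + 1) * s)) - (1 - exp (- l * s)))"
    by (rule arg_cong[where f = "\<lambda>g. set_lebesgue_integral \<mu> {0<..} g"])
      (auto simp: fun_eq_iff algebra_simps simp flip: exp_add)
  also have "\<dots> = (LINT s:{0<..}|\<mu>. 1 - exp (- (l + 1) * s)) - (LINT s:{0<..}|\<mu>. 1 - exp (- l * s))"
    using l by (intro set_integral_diff integrable_one_minus_exp) auto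
  finally show ?thesis by (simp add: \<phi>_def algebra_simps)
qed

text \<open>The weight again gives a difference of kernels at \<open>l\<close> and
  \<open>l + 1\<close>. Since \<open>l = 0\<close> occurs, \<open>\<phi>\<close> takes the place of
  \<open>f\<close>.\<close>

lemma integral_exp_N:
  assumes t: "t > 0" and l: "0 \<le> l"
  shows "(LINT s|N t. exp (- (l * s))) = (exp (- t * \<phi> l) - exp (- t * \<phi> (l + 1))) / t"
proof -
  have int: "set_integrable (\<nu> t) {0..} (\<lambda>s. exp (- c * s))" if "0 \<le> c" for c
    by (rule integrable_\<nu>[where C = 1]) (use t that in auto)
  have "(LINT s|N t. exp (- (l * s)))
      = (LINT s:{0..}|\<nu> t. ((1 - exp (- s)) / t) *\<^sub>R exp (- (l * s)))"
    unfolding N_def if_P[OF t] using t by (intro integrable_weighted_measure(2)) auto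
  also have "\<dots> = (LINT s:{0..}|\<nu> t. (exp (- l * s) - exp (- (l + 1) * s)) / t)"
    by (rule arg_cong[where f = "\<lambda>g. set_lebesgue_integral (\<nu> t) {0..} g"])
      (auto simp: fun_eq_iff algebra_simps diff_divide_distrib simp flip: exp_add)
  also have "\<dots> = ((LINT s:{0..}|\<nu> t. exp (- l * s)) - (LINT s:{0..}|\<nu> t. exp (- (l + 1) * s))) / t"
    using set_integral_diff(2)[OF int[of l] int[of "l + 1"]] l by (simp only: set_integral_divide_zero)
  finally show ?thesis using Laplace_\<nu>_\<phi>[of t l] Laplace_\<nu>_\<phi>[of t "l + 1"] t l by simp
qed

sublocale Laplace_convergence "at_right 0" N M b
proof (rule Laplace_convergence.intro)
  fix l :: real assume l: "0 \<le> l"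
  \<comment> \<open>Inserting 1 splits the transform of \<open>N t\<close> into two difference
    quotients at \<open>t = 0\<close>.\<close>
  have "((\<lambda>t. (exp (- t * \<phi> l) - 1) / t - (exp (- t * \<phi> (l + 1)) - 1) / t)
      \<longlongrightarrow> - \<phi> l - (- \<phi> (l + 1))) (at_right 0)"
    by (intro tendsto_diff exp_difference_quotient)
  then have "((\<lambda>t. (exp (- t * \<phi> l) - 1) / t - (exp (- t * \<phi> (l + 1)) - 1) / t)
      \<longlongrightarrow> b + (LINT s|M. exp (- (l * s)))) (at_right 0)"
    using integral_exp_M[OF l] by simp
  then show "((\<lambda>t. LINT s|N t. exp (- (l * s))) \<longlongrightarrow> b + (LINT s|M. exp (- (l * s)))) (at_right 0)"
  proof (rule Lim_transform_eventually)
    show "\<forall>\<^sub>F t in at_right 0. (exp (- t * \<phi> l) - 1) / t - (exp (- t * \<phi> (l + 1)) - 1) / t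
        = (LINT s|N t. exp (- (l * s)))"
      using integral_exp_N[OF _ l] by (auto simp: eventually_at_filter field_simps)
  qed
qed (rule halfline_N halfline_M ab)+

end

section \<open>Orbits of a semigroup\<close>

context seminormed_space
begin

lemma orbit_bounded:
  assumes T: "equibounded P T" and p: "p \<in> P"
  obtains C where "\<And>t. 0 \<le> t \<Longrightarrow> p (T t x) \<le> C"
proof -
  define S where "S = (SUP (y, t)\<in>{x} \<times> {0..}. ereal (p (T t y)))"
  have "seminorm_bounded P {x}" unfolding seminorm_bounded_def by auto
  then have S: "S < \<infinity>" using T p unfolding equibounded_def S_def by blast
  have le: "ereal (p (T t x)) \<le> S" if "0 \<le> t" for t
    unfolding S_def by (rule SUP_upper2[of "(x, t)"]) (use that in auto)
  show thesis
  proof (rule that[of "real_of_ereal S"])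
    fix t :: real assume "0 \<le> t"
    from le[OF this] S show "p (T t x) \<le> real_of_ereal S" by (cases S) auto
  qed
qed

text \<open>With \<open>m = min (X n) s\<close>, the difference of \<open>T (X n) x\<close> and
  \<open>T s x\<close> is, up to sign, \<open>T m\<close> applied to \<open>T (d n) x - x\<close>.
  These vectors tend to 0 and \<open>m \<le> s\<close>, so local equicontinuity applies; as it is
  sequential, the limit is tested on sequences.\<close>

lemma orbit_continuous:
  assumes T: "C0_semigroup smul P T" "locally_seq_equicontinuous P T" and s: "0 \<le> s"
  shows "limitin \<tau> (\<lambda>r. T r x) (T s x) (at s within {0..})"
  unfolding limitin_iff
proof
  fix p assume p: "p \<in> P"
  have lin: "Vector_Spaces.linear smul smul (T t)" if "0 \<le> t" for t
    using T(1) that unfolding C0_semigroup_def operator_semigroup_def by blast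
  have mult: "T (u + t) x = T u (T t x)" if "0 \<le> u" "0 \<le> t" for u t
    using T(1) that unfolding C0_semigroup_def operator_semigroup_def by simp
  show "((\<lambda>r. p (T r x - T s x)) \<longlongrightarrow> 0) (at s within {0..})"
    unfolding tendsto_at_iff_sequentially
  proof (intro allI impI)
    fix X :: "nat \<Rightarrow> real"
    assume X: "\<forall>n. X n \<in> {0..} - {s}" and lim: "X \<longlonglongrightarrow> s"
    define d where "d n = \<bar>X n - s\<bar>" for n
    define y where "y n = T (d n) x - x" for n
    have "d \<longlonglongrightarrow> 0"
      unfolding d_def using lim by (intro tendsto_rabs_zero LIM_zero)
    moreover have "\<forall>\<^sub>F n in sequentially. d n > 0"
      using X by (intro always_eventually) (simp add: d_def)
    ultimately have "filterlim d (at_right 0) sequentially"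
      unfolding filterlim_at by (auto elim!: eventually_mono)
    moreover have "limitin \<tau> (\<lambda>t. T t x - x) (x - x) (at_right 0)"
      using T(1) unfolding C0_semigroup_def by (intro limitin_diff limitin_const') blast
    ultimately have "limitin \<tau> y 0 sequentially"
      unfolding limitin_iff y_def by (auto intro: filterlim_compose)
    \<comment> \<open>The interval ends at \<open>s + 1\<close> since its end must be positive and
      \<open>s\<close> may be 0.\<close>
    then have sup: "(\<lambda>n. SUP t\<in>{0..s + 1}. ereal (p (T t (y n)))) \<longlonglongrightarrow> 0"
      using T(2) p s unfolding locally_seq_equicontinuous_def by auto
    have "(\<lambda>n. ereal (p (T (X n) x - T s x))) \<longlonglongrightarrow> 0"
    proof (rule tendsto_sandwich[OF _ _ tendsto_const sup])
      show "\<forall>\<^sub>F n in sequentially. ereal (p (T (X n) x - T s x))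
          \<le> (SUP t\<in>{0..s + 1}. ereal (p (T t (y n))))"
      proof (intro always_eventually allI)
        fix n
        have X0: "0 \<le> X n" using X by auto
        define m where "m = min (X n) s"
        have m: "0 \<le> m" "m \<le> s" using X0 s by (auto simp: m_def)
        interpret Vector_Spaces.linear smul smul "T m" by (rule lin[OF m(1)])
        have "T m (y n) = T (m + d n) x - T m x"
          using m by (simp add: y_def diff mult d_def)
        then have "p (T (X n) x - T s x) = p (T m (y n))"
          by (cases "X n \<le> s") (auto simp: m_def d_def min_def seminorm_diff_commute[OF p])
        then show "ereal (p (T (X n) x - T s x)) \<le> (SUP t\<in>{0..s + 1}. ereal (p (T t (y n))))"
          using m by (auto intro!: SUP_upper)
      qed
    qed (simp add: seminorm_nonneg p)
    then show "((\<lambda>r. p (T r x - T s x)) \<circ> X) \<longlonglongrightarrow> 0"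
      by (simp add: o_def zero_ereal_def)
  qed
qed

text \<open>Dividing by \<open>1 - exp (- s)\<close> instead of \<open>s\<close> keeps the weighted measures expressible by Laplace
  transforms at \<open>l\<close> and \<open>l + 1\<close>.\<close>

definition slope :: "(real \<Rightarrow> 'a \<Rightarrow> 'a) \<Rightarrow> 'a \<Rightarrow> 'a \<Rightarrow> real \<Rightarrow> 'a" where
  "slope T x y s = (if s \<le> 0 then y else rmul (inverse (1 - exp (- s))) (T s x - x))"

lemma slope_mult: "0 < s \<Longrightarrow> rmul (1 - exp (- s)) (slope T x y s) = T s x - x"
  by (simp add: slope_def flip: of_real_mult)

text \<open>At \<open>s = 0\<close> the function is constant to the left, and to the right it is the
  generator quotient times \<open>t / (1 - exp (- t))\<close>, a factor tending to 1. For
  \<open>s > 0\<close> it inherits continuity from the orbit.\<close>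

lemma continuous_map_slope:
  assumes T: "C0_semigroup smul P T" "locally_seq_equicontinuous P T"
    and y: "limitin \<tau> (\<lambda>t. rmul (1 / t) (T t x - x)) y (at_right 0)"
  shows "continuous_map euclidean \<tau> (slope T x y)"
  unfolding continuous_map_iff
proof
  fix s :: real
  consider "s < 0" | "s = 0" | "s > 0" by linarith
  then show "limitin \<tau> (slope T x y) (slope T x y s) (at s)"
  proof cases
    case 1
    from order_tendstoD(2)[OF tendsto_ident_at 1] have "\<forall>\<^sub>F r in at s. slope T x y s = slope T x y r"
      by eventually_elim (use 1 in \<open>simp add: slope_def\<close>)
    from limitin_transform_eventually[OF this limitin_const'] show ?thesis .
  next
    case 3
    from order_tendstoD(1)[OF tendsto_ident_at 3] have ev: "\<forall>\<^sub>F r in at s. rmul (inverse (1 - exp (- r))) (T r x - x) = slope T x y r"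
      by eventually_elim (simp add: slope_def)
    have "at s within {0..} = at s" using 3 by (intro at_within_interior) simp
    then have "limitin \<tau> (\<lambda>r. T r x) (T s x) (at s)"
      using orbit_continuous[OF T, of s x] 3 by simp
    then have lim: "limitin \<tau> (\<lambda>r. rmul (inverse (1 - exp (- r))) (T r x - x))
        (rmul (inverse (1 - exp (- s))) (T s x - x)) (at s)"
      using 3 by (intro limitin_smul limitin_diff limitin_const' tendsto_of_real tendsto_intros) auto
    have eq: "slope T x y s = rmul (inverse (1 - exp (- s))) (T s x - x)"
      using 3 by (simp add: slope_def)
    show ?thesis unfolding eq by (rule limitin_transform_eventually[OF ev lim])
  next
    case 2
    have "((\<lambda>t. (exp (- t) - 1) / t) \<longlongrightarrow> - 1) (at_right (0::real))"
      using exp_difference_quotient[of 1] by simp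
    then have "((\<lambda>t. inverse (- ((exp (- t) - 1) / t))) \<longlongrightarrow> inverse (- (- 1))) (at_right (0::real))"
      by (intro tendsto_intros) auto
    then have "limitin \<tau> (\<lambda>t. rmul (inverse (- ((exp (- t) - 1) / t))) (rmul (1 / t) (T t x - x)))
        (rmul (inverse (- (- 1))) y) (at_right 0)"
      by (intro limitin_smul y tendsto_of_real)
    then have "limitin \<tau> (\<lambda>t. rmul (inverse (- ((exp (- t) - 1) / t))) (rmul (1 / t) (T t x - x)))
        y (at_right 0)" by simp
    moreover have "\<forall>\<^sub>F t in at_right 0.
        rmul (inverse (- ((exp (- t) - 1) / t))) (rmul (1 / t) (T t x - x)) = slope T x y t"
      unfolding eventually_at_filter
    proof (intro always_eventually allI impI)
      fix t :: real assume "t \<noteq> 0" "t \<in> {0<..}"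
      then have *: "inverse (- ((exp (- t) - 1) / t)) * (1 / t) = inverse (1 - exp (- t))"
        by (simp add: field_simps)
      have "slope T x y t = rmul (inverse (1 - exp (- t))) (T t x - x)"
        using \<open>t \<in> {0<..}\<close> by (simp add: slope_def)
      then show "rmul (inverse (- ((exp (- t) - 1) / t))) (rmul (1 / t) (T t x - x)) = slope T x y t"
        by (simp only: scale_scale * flip: of_real_mult)
    qed
    ultimately have right: "limitin \<tau> (slope T x y) y (at_right 0)"
      by (rule limitin_transform_eventually[rotated])
    have "\<forall>\<^sub>F t in at_left 0. y = slope T x y t"
      by (auto simp: eventually_at_filter slope_def)
    from limitin_transform_eventually[OF this limitin_const'] right have "limitin \<tau> (slope T x y) y (at 0)"
      unfolding limitin_iff by (auto simp: filterlim_at_split)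
    then show ?thesis using 2 by (simp add: slope_def)
  qed
qed

text \<open>Compactness settles \<open>[0, 1]\<close>; beyond 1 the denominator is at least
  \<open>1 - exp (- 1)\<close> and the orbit is bounded.\<close>

lemma slope_bounded:
  assumes T: "C0_semigroup smul P T" "locally_seq_equicontinuous P T" "equibounded P T"
    and y: "limitin \<tau> (\<lambda>t. rmul (1 / t) (T t x - x)) y (at_right 0)"
  shows "seminorm_bounded P (slope T x y ` {0..})"
  unfolding seminorm_bounded_def
proof
  fix p assume p: "p \<in> P"
  have "continuous_on {0..1} (\<lambda>s. p (slope T x y s))"
    using continuous_on_seminorm[OF p continuous_map_slope[OF T(1,2) y]]
    by (rule continuous_on_subset) simp
  then have "bounded ((\<lambda>s. p (slope T x y s)) ` {0..1})"
    by (intro compact_imp_bounded compact_continuous_image) auto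
  then obtain C1 where "\<forall>r\<in>(\<lambda>s. p (slope T x y s)) ` {0..1}. norm r \<le> C1"
    unfolding bounded_iff by blast
  then have C1: "p (slope T x y s) \<le> C1" if "s \<in> {0..1}" for s
    using that seminorm_nonneg[OF p] by simp
  obtain C where C: "\<And>t. 0 \<le> t \<Longrightarrow> p (T t x) \<le> C" using orbit_bounded[OF T(3) p] by blast
  define C2 where "C2 = inverse (1 - exp (- 1)) * (C + p x)"
  have "p (slope T x y s) \<le> max C1 C2" if s: "0 \<le> s" for s
  proof (cases "s \<le> 1")
    case True
    then show ?thesis using C1[of s] s by simp
  next
    case False
    have "p (slope T x y s) = inverse (1 - exp (- s)) * p (T s x - x)"
      using False by (simp add: slope_def seminorm_rmul p del: of_real_inverse of_real_diff)
    also have "\<dots> \<le> C2"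
      unfolding C2_def
      using False C[OF s] seminorm_diff[OF p, of "T s x" x] seminorm_nonneg[OF p, of "T s x - x"]
      by (intro mult_mono le_imp_inverse_le) auto
    finally show ?thesis by simp
  qed
  then show "\<exists>C. \<forall>x\<in>slope T x y ` {0..}. p x \<le> C" by auto
qed

lemma has_Pettis_integral_cong:
  assumes "\<And>w. w \<in> \<Omega> \<Longrightarrow> g w = h w"
  shows "has_Pettis_integral smul P M \<Omega> g x \<longleftrightarrow> has_Pettis_integral smul P M \<Omega> h x"
proof -
  have "(\<lambda>w. indicator \<Omega> w *\<^sub>R x' (g w)) = (\<lambda>w. indicator \<Omega> w *\<^sub>R x' (h w))" for x' :: "'a \<Rightarrow> 'k"
    by (rule ext) (use assms in \<open>simp split: split_indicator\<close>)
  then show ?thesis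
    unfolding has_Pettis_integral_def set_integrable_def set_lebesgue_integral_def by simp
qed

lemma has_Pettis_integral_const_on:
  assumes "set_integrable M \<Omega> (\<lambda>_. 1 :: real)"
  shows "has_Pettis_integral smul P M \<Omega> (\<lambda>_. x) (rmul (LINT w:\<Omega>|M. 1) x)"
  unfolding has_Pettis_integral_def
proof
  fix x' assume x': "x' \<in> continuous_dual smul P"
  interpret Vector_Spaces.linear smul "(*)" x' using x' by (rule dual_linear)
  have "indicator \<Omega> w *\<^sub>R x' x = of_real (indicator \<Omega> w *\<^sub>R (1::real)) * x' x" for w
    by (simp add: scaleR_conv_of_real)
  then show "set_integrable M \<Omega> (\<lambda>w. x' x) \<and> x' (rmul (LINT w:\<Omega>|M. 1) x) = (LINT w:\<Omega>|M. x' x)"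
    using assms unfolding set_integrable_def set_lebesgue_integral_def
    by (simp add: scale del: real_scaleR_def scaleR_one)
qed

end

text \<open>Limits are unique in a Hausdorff space, so the \<open>THE\<close> picks the
  limit.\<close>

lemma (in Hausdorff_seminormed_space) generator_eq_Some_iff:
  "generator smul P T x = Some y \<longleftrightarrow> limitin \<tau> (\<lambda>t. rmul (1 / t) (T t x - x)) y (at_right 0)"
proof -
  have unique: "z = y" if "limitin \<tau> (\<lambda>t. rmul (1 / t) (T t x - x)) y (at_right 0)"
    "limitin \<tau> (\<lambda>t. rmul (1 / t) (T t x - x)) z (at_right 0)" for y z
    using limitin_Hausdorff_unique[OF that(2,1) _ Hausdorff] by simp
  then show ?thesis
    unfolding generator_def Let_def by (auto intro: theI2)
qed

theorem theorem4p14: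
  fixes smul :: "'k::{real_normed_field,euclidean_space} \<Rightarrow> 'a::ab_group_add \<Rightarrow> 'a"
    and P :: "('a \<Rightarrow> real) set"
    and T :: "real \<Rightarrow> 'a \<Rightarrow> 'a"
    and f :: "real \<Rightarrow> real"
    and a b :: real
    and \<mu> :: "real measure"
    and \<nu> :: "real \<Rightarrow> real measure"
  defines "A \<equiv> neg_generator smul P T"
    and "Af \<equiv> neg_generator smul P (subordinated_semigroup smul P T \<nu>)"
  assumes "seq_complete_Hausdorff_lcs smul P"
    and "C0_semigroup smul P T"
    and "locally_seq_equicontinuous P T"
    and "equibounded P T"
    and "Bernstein_function f"
    and "Levy_triplet f a b \<mu>"
    and "convolution_semigroup_of f \<nu>"
  shows "dom A \<subseteq> dom Af \<and> Af |` dom A = Bernstein_operator smul P T a b \<mu>"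
proof -
  interpret vector_space smul
    using assms(3) unfolding seq_complete_Hausdorff_lcs_def by blast
  interpret seq_complete_space smul P
    using assms(3) unfolding seq_complete_Hausdorff_lcs_def directed_seminorms_def
    by unfold_locales blast+
  interpret Bernstein_convolution f a b \<mu> \<nu>
    using assms(8,9) by unfold_locales
  let ?S = "subordinated_semigroup smul P T \<nu>"
  have T0: "T 0 x = x" for x
    using assms(4) unfolding C0_semigroup_def operator_semigroup_def by simp
  \<comment> \<open>Here \<open>y\<close> stands for \<open>- A x\<close>, so the value is the
    negative of \<open>a x + b A x\<close> plus the integral.\<close>
  have key: "generator smul P ?S x
      = Some (rmul (- a) x + (rmul b y - Pettis_integral smul P \<mu> {0<..} (\<lambda>t. x - T t x)))"
    if gen: "generator smul P T x = Some y" for x y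
  proof -
    have y: "limitin \<tau> (\<lambda>t. rmul (1 / t) (T t x - x)) y (at_right 0)"
      using gen unfolding generator_eq_Some_iff .
    define h where "h = slope T x y"
    have h: "continuous_map euclidean \<tau> h" "seminorm_bounded P (h ` {0..})"
      unfolding h_def using continuous_map_slope slope_bounded assms(4-6) y by auto
    have h0: "h 0 = y" by (simp add: h_def slope_def)
    have "\<exists>z. has_Pettis_integral smul P (N t) UNIV h z" for t
      using Pettis_integral_exists[OF halfline_N h] by blast
    then obtain zN where zN: "\<And>t. has_Pettis_integral smul P (N t) UNIV h (zN t)" by metis
    obtain z where z: "has_Pettis_integral smul P M UNIV h z"
      using Pettis_integral_exists[OF halfline_M h] by blast
    have lim: "limitin \<tau> zN (rmul b y + z) (at_right 0)"
      using limitin_Pettis_integral[OF Laplace_convergence_axioms h zN z] by (simp add: h0)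
    have "has_Pettis_integral smul P \<mu> {0<..} (\<lambda>s. rmul (1 - exp (- s)) (h s)) z"
      by (rule has_Pettis_integral_weighted) (use z in \<open>auto simp: M_def\<close>)
    then have "has_Pettis_integral smul P \<mu> {0<..} (\<lambda>s. T s x - x) z"
      by (rule has_Pettis_integral_cong[THEN iffD1, rotated]) (simp only: h_def slope_mult greaterThan_iff)
    from has_Pettis_integral_smul[OF this, of "- 1"]
    have "Pettis_integral smul P \<mu> {0<..} (\<lambda>t. x - T t x) = - z"
      by (intro Pettis_integral_eq) simp
    \<comment> \<open>Split \<open>T s x = x + (T s x - x)\<close>: the constant contributes the
      total mass of \<open>\<nu> t\<close>, the difference is \<open>t\<close> times the weighted
      integrand.\<close>
    moreover have S: "?S t x = rmul (exp (- t * a)) x + rmul t (zN t)" if t: "t > 0" for t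
    proof -
      have "has_Pettis_integral smul P (\<nu> t) {0..} (\<lambda>s. rmul ((1 - exp (- s)) / t) (h s)) (zN t)"
        by (rule has_Pettis_integral_weighted) (use zN[of t] t in \<open>auto simp: N_def\<close>)
      from has_Pettis_integral_smul[OF this, of "of_real t"]
      have "has_Pettis_integral smul P (\<nu> t) {0..} (\<lambda>s. T s x - x) (rmul t (zN t))"
      proof (rule has_Pettis_integral_cong[THEN iffD1, rotated])
        \<comment> \<open>At \<open>s = 0\<close> both the weight and \<open>T 0 x - x\<close>
          vanish; for \<open>s > 0\<close> the definition of the slope applies.\<close>
        fix s :: real assume "s \<in> {0..}"
        then show "rmul t (rmul ((1 - exp (- s)) / t) (h s)) = T s x - x"
          using slope_mult[of s T x y] t T0 by (cases "s = 0") (auto simp: h_def simp flip: of_real_mult)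
      qed
      moreover have "has_Pettis_integral smul P (\<nu> t) {0..} (\<lambda>_. x) (rmul (exp (- t * a)) x)"
      proof -
        have "set_integrable (\<nu> t) {0..} (\<lambda>_. 1 :: real)"
          using t by (intro integrable_\<nu>[where C = 1]) auto
        from has_Pettis_integral_const_on[OF this] show ?thesis
          using Laplace_\<nu>_\<phi>[of t 0] t by (simp add: \<phi>_0)
      qed
      ultimately have "has_Pettis_integral smul P (\<nu> t) {0..} (\<lambda>s. T s x)
          (rmul (exp (- t * a)) x + rmul t (zN t))"
        using has_Pettis_integral_add by fastforce
      then show ?thesis
        unfolding subordinated_semigroup_def by (rule Pettis_integral_eq)
    qed
    \<comment> \<open>The loss of mass gives \<open>- a x\<close> through the derivative of
      \<open>exp (- t * a)\<close> at 0, and \<open>zN\<close> tends to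
      \<open>b y + z\<close>.\<close>
    moreover have "limitin \<tau> (\<lambda>t. rmul (1 / t) (?S t x - x)) (rmul (- a) x + (rmul b y + z)) (at_right 0)"
    proof (rule limitin_transform_eventually)
      show "limitin \<tau> (\<lambda>t. rmul ((exp (- t * a) - 1) / t) x + zN t)
          (rmul (- a) x + (rmul b y + z)) (at_right 0)"
        by (intro limitin_add limitin_smul limitin_const' lim tendsto_of_real exp_difference_quotient)
      have "rmul ((exp (- t * a) - 1) / t) x + zN t = rmul (1 / t) (?S t x - x)" if t: "t > 0" for t
      proof -
        have "?S t x - x = rmul (exp (- t * a) - 1) x + rmul t (zN t)"
          by (simp add: S[OF t] scale_left_diff_distrib)
        then have "rmul (1 / t) (?S t x - x)
            = smul (of_real (1 / t) * of_real (exp (- t * a) - 1)) x + smul (of_real (1 / t) * of_real t) (zN t)"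
          by (simp only: scale_right_distrib scale_scale)
        then show ?thesis using t by (simp flip: of_real_mult)
      qed
      then show "\<forall>\<^sub>F t in at_right 0. rmul ((exp (- t * a) - 1) / t) x + zN t = rmul (1 / t) (?S t x - x)"
        by (auto simp: eventually_at_filter)
    qed
    ultimately show ?thesis unfolding generator_eq_Some_iff by simp
  qed
  have domA: "dom A = dom (generator smul P T)" and domAf: "dom Af = dom (generator smul P ?S)"
    unfolding A_def Af_def neg_generator_def dom_def by auto
  have "dom A \<subseteq> dom Af" unfolding domA domAf using key by auto
  moreover have "(Af |` dom A) x = Bernstein_operator smul P T a b \<mu> x" for x
  proof (cases "generator smul P T x")
    case None
    then show ?thesis
      by (simp add: domA Bernstein_operator_def neg_generator_def restrict_map_def domIff)
  next
    case (Some y)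
    then have "x \<in> dom A" by (auto simp: domA)
    then show ?thesis
      using Some key[OF Some]
      by (simp add: Af_def Bernstein_operator_def neg_generator_def)
  qed
  ultimately show ?thesis by (auto simp: fun_eq_iff)
qed

end
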